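(* For every positive integer $k$, the relative frequency $\mu_1(\text{"}k\text{"})$ of edges of integer length $k$ of one-dimensional continued fractions coincides, up to the factor $$\ln 2=\int\limits_{-1}^{0}\int\limits_{1}^{+\infty}\frac{dx\,dy}{(x-y)^2}$$ (where $x$ ranges over $[-1,0]$ and $y$ over $[1,+\infty)$), with the Gauss–Kuzmin frequency $P(k)$ of $k$ as an element of ordinary continued fractions; that is, $$\mu_1(\text{"}k\text{"})=\ln 2\cdot P(k).$$
   Context: Gauss–Kuzmin frequency: every irrational $\alpha\in[0,1]$ has a unique infinite ordinary continued fraction $\alpha=[0,a_1,a_2,\ldots]$ with positive integers $a_i$. For positive integers $k,n$ let $P_n(k)$ be the Lebesgue measure of the set of $\alpha\in[0,1]$ with $a_n=k$. The frequency of $k$ is $P(k)=\lim_{n\to\infty}P_n(k)$. One-dimensional continued fractions (in the sense of Klein): two distinct straight lines through the origin of $\mathbb{R}^2$ divide the plane into four open cones. The sail of a cone is the boundary of the convex hull of all integer points, except the origin, of the closure of the cone. The set of the four sails is the one-dimensional continued fraction related to the two lines. A (one-dimensional) face of it is an edge (segment) of one of these broken lines. A continued fraction is identified with the unordered pair of lines defining it; $CF_1$ denotes the set of all of them. $FCF_1$ is the set of ordered pairs of distinct lines through the origin in $\mathbb{R}^2$, an open subset of $\mathbb{R}P^1\times\mathbb{R}P^1$, and $p:FCF_1\to CF_1$ is the 2-fold covering forgetting the order. For a line $l\subset\mathbb{R}^2$ not through the origin with a Euclidean coordinate, the chart $FCF_{1,l}$ consists of the pairs in which both lines intersect $l$,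 with coordinates $(x_l,y_l)$ equal to the coordinates on $l$ of the intersection points of $l$ with the first and the second line. Let $\omega_1$ be the $PGL(2,\mathbb{R})$-invariant 2-form on $FCF_1$ whose restriction to the chart $FCF_{1,l}$ is $\frac{dx_l\wedge dy_l}{|x_l-y_l|^2}$, and let $\mu_{\omega_1}$ be the measure given by $\mu_{\omega_1}(S)=\left|\int_S\omega_1\right|$ for open measurable $S$ in one connected component. The measure $\mu_1$ on $CF_1$ is the projection of $\mu_{\omega_1}$, normalized by $$\mu_1(E)=\tfrac12\,\mu_{\omega_1}(p^{-1}(E)).$$ For a segment $F$ with integer endpoints, $CF_1(F)\subset CF_1$ is the set of continued fractions that contain $F$ as a face, and $\mu_1(CF_1(F))$ is called the relative frequency of $F$. The integer length of a segment with integer endpoints is the number of integer points in its interior plus one. A line containing at least two integer points and not passing through the origin is at unit integer distance from the origin if its Euclidean distance to the origin equals the minimal nonzero Euclidean distance from integer points to this line. The relative frequency depends only on the class of $F$ under lattice-preserving linear maps. All faces of one-dimensional continued fractions are at unit integer distance from the origin, so this class is determined by the integer length $k$; $\mu_1(\text{"}k\text{"})=\mu_1(CF_1(F))$ for any segment $F$ of integer length $k$ at unit integer distance from the origin, e.g. the segment with vertices $(0,1)$ and $(k,1)$. *)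

theory Defs
  imports "HOL-Analysis.Analysis"
begin

section \<open>Gauss--Kuzmin frequencies\<close>

fun cf_value :: "nat list \<Rightarrow> real" where
  "cf_value [] = 0"
| "cf_value (a # as) = 1 / (real a + cf_value as)"

text \<open>\<open>has_cf a \<alpha>\<close> means \<open>\<alpha> = [0, a 1, a 2, \<dots>]\<close>; the value \<open>a 0\<close> is not used.\<close>

definition has_cf :: "(nat \<Rightarrow> nat) \<Rightarrow> real \<Rightarrow> bool" where
  "has_cf a \<alpha> \<longleftrightarrow>
     (\<forall>i\<ge>1. a i > 0) \<and> (\<lambda>n. cf_value (map a [1..<Suc n])) \<longlonglongrightarrow> \<alpha>"

definition gauss_kuzmin_measure :: "nat \<Rightarrow> nat \<Rightarrow> real" where
  "gauss_kuzmin_measure n k =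
     measure lebesgue {\<alpha> \<in> {0..1}. \<alpha> \<notin> \<rat> \<and> (\<exists>a. has_cf a \<alpha> \<and> a n = k)}"

definition gauss_kuzmin_freq :: "nat \<Rightarrow> real" where
  "gauss_kuzmin_freq k = lim (\<lambda>n. gauss_kuzmin_measure n k)"


section \<open>One-dimensional continued fractions in the sense of Klein\<close>

definition int_points :: "(real^2) set" where
  "int_points = {z. \<forall>i. z $ i \<in> \<int>}"

definition lines0 :: "(real^2) set set" where
  "lines0 = {l. subspace l \<and> dim l = 1}"

definition FCF1 :: "((real^2) set \<times> (real^2) set) set" where
  "FCF1 = {(l, m). l \<in> lines0 \<and> m \<in> lines0 \<and> l \<noteq> m}"

definition forget_order :: "(real^2) set \<times> (real^2) set \<Rightarrow> (real^2) set set" where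
  "forget_order = (\<lambda>(l, m). {l, m})"

definition CF1 :: "(real^2) set set set" where
  "CF1 = forget_order ` FCF1"

definition open_cones :: "(real^2) set set \<Rightarrow> (real^2) set set" where
  "open_cones c = components (- \<Union>c)"

definition cone_hull :: "(real^2) set \<Rightarrow> (real^2) set" where
  "cone_hull C = convex hull (closure C \<inter> int_points - {0})"

definition sail :: "(real^2) set \<Rightarrow> (real^2) set" where
  "sail C = frontier (cone_hull C)"

text \<open>
  A sail is the boundary of the convex region \<open>cone_hull C\<close>, so the edges of this broken
  line are the edges of that region. An edge in the sense of \<open>edge_of\<close> may also be an
  unbounded ray (when a line has rational slope); the set \<open>F\<close> below will always be a segment.
\<close>

definition is_face_of_cf :: "(real^2) set \<Rightarrow> (real^2) set set \<Rightarrow> bool" where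
  "is_face_of_cf F c \<longleftrightarrow>
     (\<exists>C \<in> open_cones c. F \<subseteq> sail C \<and> F edge_of cone_hull C)"

definition CF1_with_face :: "(real^2) set \<Rightarrow> (real^2) set set set" where
  "CF1_with_face F = {c \<in> CF1. is_face_of_cf F c}"


section \<open>The Moebius measure\<close>

text \<open>
  A line not through the origin together with a Euclidean coordinate on it is given by a point
  \<open>a\<close> (of coordinate 0) and a unit vector \<open>u\<close>: the point of coordinate \<open>t\<close> is \<open>a + t u\<close>.
\<close>

definition coord_line :: "real^2 \<Rightarrow> real^2 \<Rightarrow> (real^2) set" where
  "coord_line a u = range (\<lambda>t. a + t *\<^sub>R u)"

definition line_coord :: "real^2 \<Rightarrow> real^2 \<Rightarrow> (real^2) set \<Rightarrow> real" where
  "line_coord a u l = (THE t. a + t *\<^sub>R u \<in> l)"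

definition FCF1_chart :: "real^2 \<Rightarrow> real^2 \<Rightarrow> ((real^2) set \<times> (real^2) set) set" where
  "FCF1_chart a u =
     {(l, m) \<in> FCF1. l \<inter> coord_line a u \<noteq> {} \<and> m \<inter> coord_line a u \<noteq> {}}"

definition chart_coords ::
    "real^2 \<Rightarrow> real^2 \<Rightarrow> (real^2) set \<times> (real^2) set \<Rightarrow> real \<times> real" where
  "chart_coords a u = (\<lambda>(l, m). (line_coord a u l, line_coord a u m))"

text \<open>
  The topology of \<open>FCF1\<close> is the one of the square of the projective line: a set of pairs of
  lines is open iff the set of pairs of vectors spanning such lines is open.
\<close>

definition FCF1_open :: "((real^2) set \<times> (real^2) set) set \<Rightarrow> bool" where
  "FCF1_open U \<longleftrightarrow> U \<subseteq> FCF1 \<and> open {(v, w). (span {v}, span {w}) \<in> U}"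

definition FCF1_borel :: "((real^2) set \<times> (real^2) set) measure" where
  "FCF1_borel = sigma FCF1 {U. FCF1_open U}"

text \<open>
  The measure \<open>|\<integral>\<^sub>S \<omega>|\<close> of the 2-form \<open>\<omega>\<close> that is \<open>dx \<and> dy / |x - y|\<^sup>2\<close> in
  every chart. The form has no zeros and \<open>FCF1\<close> is connected, so taking the absolute value
  amounts to integrating the positive density \<open>1 / |x - y|\<^sup>2\<close>. This density
  is compatible with changes of charts (which act by one Moebius map on both coordinates), and
  finitely many charts cover \<open>FCF1\<close>; hence exactly one measure satisfies the description.
\<close>

definition mu_omega1 :: "((real^2) set \<times> (real^2) set) measure" where
  "mu_omega1 = (THE M. space M = FCF1 \<and> sets M = sets FCF1_borel \<and>
     (\<forall>a u. norm u = 1 \<and> 0 \<notin> coord_line a u \<longrightarrow>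
        (\<forall>S \<in> sets M. S \<subseteq> FCF1_chart a u \<longrightarrow>
           emeasure M S =
             (\<integral>\<^sup>+(x, y) \<in> chart_coords a u ` S. ennreal (1 / \<bar>x - y\<bar>^2) \<partial>lborel))))"

definition mu1 :: "(real^2) set set set \<Rightarrow> ennreal" where
  "mu1 E = emeasure mu_omega1 (forget_order -` E \<inter> FCF1) / 2"


section \<open>Integer length and integer distance\<close>

definition int_length :: "real^2 \<Rightarrow> real^2 \<Rightarrow> nat" where
  "int_length a b = card (int_points \<inter> open_segment a b) + 1"

text \<open>
  The origin is itself an integer point at nonzero distance from \<open>l\<close>, so the inequality says
  that the minimal nonzero distance exists and is the distance of the origin.
\<close>

definition unit_int_distance :: "(real^2) set \<Rightarrow> bool" where
  "unit_int_distance l \<longleftrightarrow> 0 \<notin> l \<and>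
     (\<forall>z \<in> int_points. infdist z l \<noteq> 0 \<longrightarrow> infdist 0 l \<le> infdist z l)"

end

theory Submission
  imports Defs
begin

text \<open>
  Both sides of the identity are equal to \<open>ln ((k + 1)\<^sup>2 / (k (k + 2)))\<close>, and they are computed
  independently of each other.

  \<^emph>\<open>The relative frequency.\<close> Let \<open>F\<close> be the segment from \<open>a\<close> to \<open>b = a + k e\<close>. Unit integer
  distance says that \<open>(a, e)\<close> is a basis of the integer lattice (\<open>segment_integer_basis\<close>), so the
  integer points at height one over the origin are exactly \<open>a + j e\<close>. A cone has \<open>F\<close> as an edge of
  the convex hull of its integer points iff its closure contains \<open>a\<close> and \<open>b\<close> but neither \<open>a - e\<close>
  nor \<open>b + e\<close>, that is, iff the two boundary lines cross the line of \<open>F\<close> at points \<open>a + x e\<close> and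
  \<open>a + y e\<close> with \<open>-1 < x \<le> 0\<close> and \<open>k \<le> y < k + 1\<close> (\<open>CF1_with_segment\<close>). Over ordered pairs of
  lines this is a rectangle together with its mirror image in a chart, and the factor one half in
  the measure removes the doubling. Integrating \<open>1 / (x - y)\<^sup>2\<close> over the rectangle gives the
  logarithm of a cross-ratio (\<open>nn_integral_rectangle\<close>), here the number above. To speak about the
  measure at all one has to know that the charts define one: every chart differs from a
  reference chart by a Moebius map acting on both coordinates, and \<open>dx dy / (x - y)\<^sup>2\<close> is invariant
  under such maps (\<open>chart_integral_eq_base\<close>); three charts cover everything, whence uniqueness.

  \<^emph>\<open>The Gauss--Kuzmin frequency.\<close> The digit \<open>a (n + 1)\<close> of \<open>\<alpha>\<close> is determined by the \<open>n\<close>-th iterate of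
  the Gauss map \<open>x \<mapsto> frac (1 / x)\<close>. The distribution of this iterate has a density
  \<open>g n x / (1 + x)\<close>, where \<open>g 0 x = 1 + x\<close> and \<open>g (n + 1)\<close> arises from \<open>g n\<close> by averaging over the
  inverse branches \<open>1 / (k + x)\<close> with weights of sum one (\<open>gk_density_transfer\<close>). This averaging
  turns increasing functions into decreasing ones and conversely, because for larger \<open>x\<close> the weights
  prefer larger \<open>k\<close>; and for monotone functions it at least halves the difference of the values
  at the endpoints (\<open>gk_op_oscillation\<close>). So \<open>g n\<close> tends uniformly to a constant, which must be
  \<open>1 / ln 2\<close> because the total mass is one. Integrating over the interval \<open>1 / (k + 1) < x < 1 / k\<close>
  gives the frequency \<open>ln ((k + 1)\<^sup>2 / (k (k + 2))) / ln 2\<close> (\<open>gauss_kuzmin_theorem\<close>).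
\<close>

section \<open>Moebius substitutions on the real line\<close>

text \<open>
  A nondegenerate Moebius map is a bijection of the projective line, hence of the real line up to at
  most one point on each side. At the pole both the map and the density take the value \<open>0\<close> (division by
  zero), and a single point carries no mass.
\<close>

lemma distr_moebius_lborel:
  fixes p q r t :: real
  defines "D \<equiv> q * r - p * t"
  assumes D: "D \<noteq> 0"
  shows "distr (density lborel (\<lambda>s. ennreal (\<bar>D\<bar> / (r + t * s)^2))) borel
           (\<lambda>s. (p + q * s) / (r + t * s)) = lborel"
proof (rule sym, rule lborel_eqI)
  fix l u :: real
  assume "\<And>b. b \<in> Basis \<Longrightarrow> l \<bullet> b \<le> u \<bullet> b"
  then have lu: "l \<le> u" by simp
  define g where "g = (\<lambda>s. (p + q * s) / (r + t * s))"
  \<comment> \<open>The preimage of an interval may consist of two rays, so the substitution is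
      carried out on \<open>S\<close> as a set and not on intervals.\<close>
  define S where "S = {s. r + t * s \<noteq> 0 \<and> l < g s \<and> g s < u}"
  have [measurable]: "g \<in> borel_measurable borel" by (simp add: g_def)
  have S_borel: "S \<in> sets borel" unfolding S_def by measurable
  have der: "(g has_field_derivative D / (r + t * s)^2) (at s within S)" if "s \<in> S" for s
  proof -
    have "r + t * s \<noteq> 0" using that by (simp add: S_def)
    then show ?thesis unfolding g_def D_def
      by (auto intro!: derivative_eq_intros simp: field_simps power2_eq_square)
  qed
  have inj: "inj_on g S"
  proof (rule inj_onI)
    fix s s' assume s: "s \<in> S" "s' \<in> S" and eq: "g s = g s'"
    then have "(p + q * s) * (r + t * s') = (p + q * s') * (r + t * s)"
      by (simp add: S_def g_def frac_eq_eq)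
    then have "D * (s - s') = 0" by (simp add: D_def algebra_simps)
    then show "s = s'" using D by simp
  qed
  have img: "g ` S \<subseteq> {l<..<u}" "{l<..<u} - g ` S \<subseteq> {q / t}"
  proof -
    show "g ` S \<subseteq> {l<..<u}" by (auto simp: S_def)
    show "{l<..<u} - g ` S \<subseteq> {q / t}"
    proof
      fix x assume x: "x \<in> {l<..<u} - g ` S"
      show "x \<in> {q / t}"
      proof (rule ccontr)
        assume nx: "x \<notin> {q / t}"
        have nz: "q - x * t \<noteq> 0"
        proof
          assume e: "q - x * t = 0"
          show False
          proof (cases "t = 0")
            case True then show ?thesis using e D by (simp add: D_def)
          next
            case False then show ?thesis using e nx by (simp add: field_simps)
          qed
        qed
        define s where "s = (x * r - p) / (q - x * t)"
        have "(r + t * s) * (q - x * t) = r * (q - x * t) + t * (s * (q - x * t))"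
          by (simp add: algebra_simps)
        also have "s * (q - x * t) = x * r - p" using nz by (simp add: s_def)
        finally have 1: "(r + t * s) * (q - x * t) = D" by (simp add: D_def algebra_simps)
        then have rt: "r + t * s \<noteq> 0" using D by auto
        have "s * (q - x * t) = x * r - p" using nz by (simp add: s_def)
        then have "p + q * s = x * (r + t * s)" by (simp add: algebra_simps)
        then have "g s = x" using rt by (simp add: g_def)
        then have "s \<in> S" "g s = x" using rt x by (auto simp: S_def)
        then show False using x by auto
      qed
    qed
  qed
  have "((\<lambda>_. 1::real) has_integral (u - l)) {l<..<u}"
    using has_integral_const_real[of "1::real" l u] lu
    by (simp add: has_integral_Icc_iff_Ioo)
  moreover have "negligible (({l<..<u} - g ` S) \<union> (g ` S - {l<..<u}))"
    by (rule negligible_subset[OF negligible_sing[of "q/t"]])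
       (use img in auto)
  ultimately have "((\<lambda>_. 1::real) has_integral (u - l)) (g ` S)"
    by (subst has_integral_spike_set_eq[where T="{l<..<u}"]) (auto elim: negligible_subset)
  then have "(\<lambda>_. 1::real) absolutely_integrable_on (g ` S) \<and> integral (g ` S) (\<lambda>_. 1::real) = u - l"
    by (auto simp: nonnegative_absolutely_integrable_1 has_integral_iff)
  then have "(\<lambda>s. \<bar>D / (r + t * s)^2\<bar> * 1) absolutely_integrable_on S \<and>
     integral S (\<lambda>s. \<bar>D / (r + t * s)^2\<bar> * 1) = u - l"
    by (subst has_absolute_integral_change_of_variables_1'[OF _ der inj]) (use S_borel in auto)
  then have "((\<lambda>s. \<bar>D\<bar> / (r + t * s)^2) has_integral (u - l)) S"
    by (auto simp: has_integral_iff set_lebesgue_integral_eq_integral(1))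
  then have int: "(\<integral>\<^sup>+ s. ennreal (\<bar>D\<bar> / (r + t * s)^2) * indicator S s \<partial>lborel) = ennreal (u - l)"
    by (intro nn_integral_has_integral_lebesgue') auto
  have "emeasure (distr (density lborel (\<lambda>s. ennreal (\<bar>D\<bar> / (r + t * s)^2))) borel g) {l<..<u}
      = (\<integral>\<^sup>+ s. ennreal (\<bar>D\<bar> / (r + t * s)^2) * indicator (g -` {l<..<u}) s \<partial>lborel)"
    using measurable_sets[of g borel borel "{l<..<u}"]
    by (subst emeasure_distr) (auto simp: emeasure_density)
  also have "\<dots> = (\<integral>\<^sup>+ s. ennreal (\<bar>D\<bar> / (r + t * s)^2) * indicator S s \<partial>lborel)"
    by (intro nn_integral_cong) (auto simp: S_def indicator_def)
  finally show "emeasure (distr (density lborel (\<lambda>s. ennreal (\<bar>D\<bar> / (r + t * s)^2))) borel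
           (\<lambda>s. (p + q * s) / (r + t * s))) (box l u) = ennreal (\<Prod>b\<in>Basis. (u - l) \<bullet> b)"
    by (simp add: int g_def box_real)
qed simp

lemma nn_integral_moebius:
  fixes p q r t :: real
  assumes "q * r - p * t \<noteq> 0" and [measurable]: "h \<in> borel_measurable borel"
  shows "(\<integral>\<^sup>+ s. ennreal (\<bar>q * r - p * t\<bar> / (r + t * s)^2) * h ((p + q * s) / (r + t * s)) \<partial>lborel)
       = (\<integral>\<^sup>+ x. h x \<partial>lborel)"
  by (subst (2) distr_moebius_lborel[OF assms(1), symmetric])
     (simp add: nn_integral_distr nn_integral_density)

section \<open>Lines through the origin and their coordinates\<close>

definition cross2 :: "real^2 \<Rightarrow> real^2 \<Rightarrow> real" where
  "cross2 v w = v $ 1 * w $ 2 - v $ 2 * w $ 1"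

lemma cross2_simps [simp]:
  "cross2 v v = 0" "cross2 0 w = 0" "cross2 v 0 = 0"
  "cross2 (v + v') w = cross2 v w + cross2 v' w" "cross2 v (w + w') = cross2 v w + cross2 v w'"
  "cross2 (v - v') w = cross2 v w - cross2 v' w" "cross2 v (w - w') = cross2 v w - cross2 v w'"
  "cross2 (c *\<^sub>R v) w = c * cross2 v w" "cross2 v (c *\<^sub>R w) = c * cross2 v w"
  by (auto simp: cross2_def algebra_simps)

lemma cross2_commute: "cross2 w v = - cross2 v w"
  by (simp add: cross2_def)

lemma continuous_on_cross2 [continuous_intros]:
  "continuous_on S f \<Longrightarrow> continuous_on S g \<Longrightarrow> continuous_on S (\<lambda>z. cross2 (f z) (g z))"
  unfolding cross2_def by (intro continuous_intros)

text \<open>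
  Cramer's rule: after division by \<open>cross2 v w\<close> these are the coordinates of \<open>z\<close> in the basis
  \<open>(v, w)\<close>.
\<close>

lemma cross2_expand:
  "cross2 v w *\<^sub>R z = cross2 z w *\<^sub>R v + cross2 v z *\<^sub>R w"
  by (simp add: cross2_def vec_eq_iff forall_2 algebra_simps)

lemma cross2_eq_0_iff: "w \<noteq> 0 \<Longrightarrow> cross2 v w = 0 \<longleftrightarrow> v \<in> span {w}"
proof
  assume w: "w \<noteq> 0" and *: "cross2 v w = 0"
  have e: "v = (v $ 1 / w $ 1) *\<^sub>R w" if "w $ 1 \<noteq> 0"
    using that * by (simp add: cross2_def vec_eq_iff forall_2 field_simps)
  have e': "v = (v $ 2 / w $ 2) *\<^sub>R w" if "w $ 2 \<noteq> 0"
    using that * by (simp add: cross2_def vec_eq_iff forall_2 field_simps)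
  have "w $ 1 \<noteq> 0 \<or> w $ 2 \<noteq> 0" using w by (auto simp: vec_eq_iff forall_2)
  then show "v \<in> span {w}" using e e' unfolding span_singleton by blast
qed (auto simp: span_singleton)

lemma span_sing_eq_iff:
  assumes "v \<noteq> 0" "w \<noteq> 0"
  shows "span {v} = span {w} \<longleftrightarrow> cross2 v w = 0"
proof
  assume "span {v} = span {w}"
  then have "v \<in> span {w}" using span_base[of v "{v}"] by auto
  then show "cross2 v w = 0" using cross2_eq_0_iff assms by blast
next
  assume "cross2 v w = 0"
  then obtain k where k: "v = k *\<^sub>R w"
    using cross2_eq_0_iff[of w v] assms by (auto simp: span_singleton)
  with assms have "k \<noteq> 0" by auto
  then show "span {v} = span {w}"
    using span_image_scale[of "{w}" "\<lambda>_. k"] k by auto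
qed

lemma lines0_iff: "l \<in> lines0 \<longleftrightarrow> (\<exists>v. v \<noteq> 0 \<and> l = span {v})"
proof
  assume "l \<in> lines0"
  then have l: "subspace l" "dim l = 1" by (auto simp: lines0_def)
  from basis_exists[of l] obtain B where B: "B \<subseteq> l" "independent B" "l \<subseteq> span B" "card B = dim l"
    by blast
  then obtain v where v: "B = {v}" using l by (metis card_1_singletonE)
  have "l = span {v}" using B l v by (metis span_minimal subset_antisym)
  moreover have "v \<noteq> 0" using B(2) v by (metis dependent_zero singletonI)
  ultimately show "\<exists>v. v \<noteq> 0 \<and> l = span {v}" by blast
next
  assume "\<exists>v. v \<noteq> 0 \<and> l = span {v}"
  then show "l \<in> lines0" by (auto simp: lines0_def)
qed

lemma span_sing_in_lines0_iff: "span {v} \<in> lines0 \<longleftrightarrow> v \<noteq> 0"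
proof (cases "v = 0")
  case True
  have "dim ({0} :: (real^2) set) = 0" by simp
  then show ?thesis using True by (simp add: lines0_def)
qed (auto simp: lines0_iff)

lemma span_pair_in_FCF1_iff: "(span {v}, span {w}) \<in> FCF1 \<longleftrightarrow> cross2 v w \<noteq> 0"
proof (cases "v = 0 \<or> w = 0")
  case True
  then have "(span {v}, span {w}) \<notin> FCF1"
    by (auto simp: FCF1_def span_sing_in_lines0_iff simp del: span_insert_0 span_0 span_empty)
  then show ?thesis using True by auto
qed (auto simp: FCF1_def span_sing_in_lines0_iff span_sing_eq_iff)

lemma FCF1_cases:
  assumes "p \<in> FCF1"
  obtains v w where "p = (span {v}, span {w})" "cross2 v w \<noteq> 0"
proof -
  from assms obtain v w where "p = (span {v}, span {w})"
    by (auto simp: FCF1_def lines0_iff)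
  then show ?thesis using that assms span_pair_in_FCF1_iff by blast
qed

lemma coord_line_avoids_0_iff:
  assumes "norm u = 1"
  shows "0 \<notin> coord_line a u \<longleftrightarrow> cross2 a u \<noteq> 0"
proof -
  have "u \<noteq> 0" using assms by auto
  then have "cross2 a u = 0 \<longleftrightarrow> (\<exists>k. a = k *\<^sub>R u)"
    by (auto simp: cross2_eq_0_iff span_singleton)
  also have "\<dots> \<longleftrightarrow> (\<exists>k. 0 = a + k *\<^sub>R u)"
    by (metis add.right_inverse add_eq_0_iff scaleR_minus_left minus_minus)
  finally show ?thesis by (auto simp: coord_line_def)
qed

text \<open>
  The coordinate on \<open>coord_line a u\<close> of the line spanned by \<open>v\<close> is a quotient of two linear forms
  in \<open>v\<close>; this makes it continuous in \<open>v\<close> and makes changes of charts Moebius maps.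
\<close>

lemma in_span_meets:
  assumes "cross2 a u \<noteq> 0" "v \<noteq> 0"
  shows "a + t *\<^sub>R u \<in> span {v} \<longleftrightarrow> cross2 v u \<noteq> 0 \<and> t = cross2 a v / cross2 v u"
proof -
  have "a + t *\<^sub>R u \<in> span {v} \<longleftrightarrow> cross2 a v = t * cross2 v u"
    using cross2_eq_0_iff[OF assms(2), of "a + t *\<^sub>R u"] cross2_commute[of v u]
    by (simp add: add_eq_0_iff2)
  moreover have "cross2 v u \<noteq> 0" if "cross2 a v = t * cross2 v u"
  proof
    assume 0: "cross2 v u = 0"
    with that have "cross2 a v = 0" by simp
    then have "cross2 v u *\<^sub>R a = cross2 a u *\<^sub>R v"
      using cross2_expand[of a u v] 0 by simp
    then show False using 0 assms by simp
  qed
  ultimately show ?thesis by (auto simp: field_simps)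
qed

lemma meets_coord_line_iff:
  assumes "cross2 a u \<noteq> 0" "v \<noteq> 0"
  shows "span {v} \<inter> coord_line a u \<noteq> {} \<longleftrightarrow> cross2 v u \<noteq> 0"
  using in_span_meets[OF assms] by (auto simp: coord_line_def)

lemma line_coord_span:
  assumes "cross2 a u \<noteq> 0" "cross2 v u \<noteq> 0"
  shows "line_coord a u (span {v}) = cross2 a v / cross2 v u"
proof -
  have "v \<noteq> 0" using assms by auto
  then show ?thesis unfolding line_coord_def using in_span_meets[OF assms(1)] assms(2) by auto
qed

text \<open>
  The inverse of the chart \<open>chart_coords a u\<close>; on the diagonal it leaves \<open>FCF1\<close>.
\<close>

definition line_pair :: "real^2 \<Rightarrow> real^2 \<Rightarrow> real \<times> real \<Rightarrow> (real^2) set \<times> (real^2) set" where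
  "line_pair a u = (\<lambda>(s, t). (span {a + s *\<^sub>R u}, span {a + t *\<^sub>R u}))"

lemma line_pair_in_FCF1:
  assumes "cross2 a u \<noteq> 0"
  shows "line_pair a u (s, t) \<in> FCF1 \<longleftrightarrow> s \<noteq> t"
  using assms cross2_commute[of u a]
  by (auto simp: line_pair_def span_pair_in_FCF1_iff)

lemma FCF1_chart_iff:
  assumes "cross2 a u \<noteq> 0"
  shows "(span {v}, span {w}) \<in> FCF1_chart a u \<longleftrightarrow>
           cross2 v w \<noteq> 0 \<and> cross2 v u \<noteq> 0 \<and> cross2 w u \<noteq> 0"
  using meets_coord_line_iff[OF assms, of v] meets_coord_line_iff[OF assms, of w]
  by (cases "v = 0 \<or> w = 0") (auto simp: FCF1_chart_def span_pair_in_FCF1_iff simp del: span_insert_0)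

lemma chart_coords_line_pair:
  assumes "cross2 a u \<noteq> 0"
  shows "chart_coords a u (line_pair a u z) = z"
  using assms by (cases z) (simp add: chart_coords_def line_pair_def line_coord_span)

lemma line_pair_in_chart:
  assumes "cross2 a u \<noteq> 0" "s \<noteq> t"
  shows "line_pair a u (s, t) \<in> FCF1_chart a u"
  using assms cross2_commute[of u a] by (simp add: line_pair_def FCF1_chart_iff)

lemma line_pair_chart_coords:
  assumes "cross2 a u \<noteq> 0" "p \<in> FCF1_chart a u"
  shows "line_pair a u (chart_coords a u p) = p"
proof -
  have "p \<in> FCF1" using assms by (auto simp: FCF1_chart_def)
  then obtain v w where p: "p = (span {v}, span {w})" "cross2 v w \<noteq> 0" by (rule FCF1_cases)
  have *: "cross2 v u \<noteq> 0" "cross2 w u \<noteq> 0" using assms p FCF1_chart_iff by blast+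
  have "span {a + (cross2 a v / cross2 v u) *\<^sub>R u} = span {v}" if "cross2 v u \<noteq> 0" for v
  proof -
    have v: "v \<noteq> 0" using that by auto
    have "cross2 (a + (cross2 a v / cross2 v u) *\<^sub>R u) u \<noteq> 0" using assms by simp
    then have nz: "a + (cross2 a v / cross2 v u) *\<^sub>R u \<noteq> 0" by fastforce
    have "a + (cross2 a v / cross2 v u) *\<^sub>R u \<in> span {v}"
      using in_span_meets[OF assms(1) v] that by simp
    then show ?thesis using span_sing_eq_iff[OF nz v] cross2_eq_0_iff[OF v] by blast
  qed
  with * show ?thesis
    by (simp add: p chart_coords_def line_pair_def line_coord_span assms)
qed

lemma chart_coords_image:
  assumes "cross2 a u \<noteq> 0" "S \<subseteq> FCF1_chart a u"
  shows "chart_coords a u ` S = {z. line_pair a u z \<in> S}"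
proof (intro equalityI subsetI)
  fix z assume "z \<in> chart_coords a u ` S"
  then obtain p where "p \<in> S" "z = chart_coords a u p" by auto
  then show "z \<in> {z. line_pair a u z \<in> S}"
    using line_pair_chart_coords[OF assms(1), of p] assms(2) by auto
next
  fix z assume "z \<in> {z. line_pair a u z \<in> S}"
  then show "z \<in> chart_coords a u ` S"
    by (intro rev_image_eqI[of "line_pair a u z"]) (auto simp: chart_coords_line_pair[OF assms(1)])
qed

section \<open>Measurability of charts\<close>

lemma space_FCF1_borel [simp]: "space FCF1_borel = FCF1"
  unfolding FCF1_borel_def by (rule space_measure_of) (auto simp: FCF1_open_def)

lemma sets_FCF1_borel: "sets FCF1_borel = sigma_sets FCF1 {U. FCF1_open U}"
  unfolding FCF1_borel_def by (rule sets_measure_of) (auto simp: FCF1_open_def)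

lemma FCF1_open_in_sets: "FCF1_open U \<Longrightarrow> U \<in> sets FCF1_borel"
  by (simp add: sets_FCF1_borel sigma_sets.Basic)

text \<open>
  Since \<open>FCF1\<close> carries no topology as a type, measurability of maps into it is tested by induction
  over the generated sigma-algebra: preimages of open sets under continuous families of spanning
  vectors are open, and the preimage of \<open>FCF1\<close> is open because it is given by a nonzero cross product.
\<close>

lemma borel_preimage_span_pair:
  fixes f g :: "'a::topological_space \<Rightarrow> real^2"
  assumes cont: "continuous_on UNIV f" "continuous_on UNIV g" and S: "S \<in> sets FCF1_borel"
  shows "{z. (span {f z}, span {g z}) \<in> S} \<in> sets borel"
  using S unfolding sets_FCF1_borel
proof (induction rule: sigma_sets.induct)
  case (Basic U)
  then have op: "open {(v, w). (span {v}, span {w}) \<in> U}" by (simp add: FCF1_open_def)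
  have "open ((\<lambda>z. (f z, g z)) -` {(v, w). (span {v}, span {w}) \<in> U})"
    by (rule open_vimage[OF op]) (intro continuous_intros cont)
  then show ?case by (auto simp: vimage_def)
next
  case (Compl U)
  have "open {z. cross2 (f z) (g z) \<noteq> 0}"
    by (intro open_Collect_neq continuous_intros cont)
  then have "{z. cross2 (f z) (g z) \<noteq> 0} - {z. (span {f z}, span {g z}) \<in> U} \<in> sets borel"
    using Compl by auto
  moreover have "{z. cross2 (f z) (g z) \<noteq> 0} - {z. (span {f z}, span {g z}) \<in> U}
     = {z. (span {f z}, span {g z}) \<in> FCF1 - U}"
    by (auto simp: span_pair_in_FCF1_iff)
  ultimately show ?case by simp
next
  case (Union A)
  have "{z. (span {f z}, span {g z}) \<in> (\<Union>i. A i)} = (\<Union>i. {z. (span {f z}, span {g z}) \<in> A i})"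
    by auto
  then show ?case using Union by auto
qed simp

lemma borel_line_pair:
  assumes "S \<in> sets FCF1_borel"
  shows "{z. line_pair a u z \<in> S} \<in> sets borel"
proof -
  have "{z. (span {a + fst z *\<^sub>R u}, span {a + snd z *\<^sub>R u}) \<in> S} \<in> sets borel"
    by (rule borel_preimage_span_pair[OF _ _ assms]) (intro continuous_intros)+
  then show ?thesis by (simp add: line_pair_def case_prod_beta)
qed

text \<open>
  On spanning vectors a chart is the map \<open>c\<close> below, continuous on the open set \<open>W\<close> of pairs
  whose lines meet the coordinate line; so preimages of open sets are open, and the Borel sets follow
  by induction.
\<close>

lemma chart_coords_measurable:
  assumes au: "cross2 a u \<noteq> 0" and B: "B \<in> sets borel"
  shows "{p \<in> FCF1_chart a u. chart_coords a u p \<in> B} \<in> sets FCF1_borel"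
proof -
  define W where "W = {z :: (real^2) \<times> (real^2). cross2 (fst z) (snd z) \<noteq> 0 \<and>
                cross2 (fst z) u \<noteq> 0 \<and> cross2 (snd z) u \<noteq> 0}"
  define c where "c = (\<lambda>z :: (real^2) \<times> (real^2).
                (cross2 a (fst z) / cross2 (fst z) u, cross2 a (snd z) / cross2 (snd z) u))"
  have W: "open W" unfolding W_def
    by (intro open_Collect_conj open_Collect_neq continuous_intros)
  have c: "continuous_on W c" unfolding c_def
    by (intro continuous_intros) (auto simp: W_def)
  have op: "FCF1_open {p \<in> FCF1_chart a u. chart_coords a u p \<in> U}" if "open U" for U
  proof -
    have "{(v, w). (span {v}, span {w}) \<in> {p \<in> FCF1_chart a u. chart_coords a u p \<in> U}}
        = c -` U \<inter> W"
      by (auto simp: W_def c_def FCF1_chart_iff[OF au] chart_coords_def line_coord_span[OF au])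
    moreover have "open (c -` U \<inter> W)" using c W that by (simp add: continuous_on_open_vimage)
    ultimately show ?thesis by (auto simp: FCF1_open_def FCF1_chart_def)
  qed
  have "B \<in> sigma_sets UNIV {U. open U}" using B by (simp add: borel_def)
  then show ?thesis
  proof (induction rule: sigma_sets.induct)
    case (Basic U)
    then show ?case using op FCF1_open_in_sets by auto
  next
    case (Compl U)
    have "{p \<in> FCF1_chart a u. chart_coords a u p \<in> UNIV - U}
      = {p \<in> FCF1_chart a u. chart_coords a u p \<in> UNIV} - {p \<in> FCF1_chart a u. chart_coords a u p \<in> U}"
      by auto
    then show ?case using Compl op[of UNIV] FCF1_open_in_sets by auto
  next
    case (Union A)
    have "{p \<in> FCF1_chart a u. chart_coords a u p \<in> (\<Union>i. A i)}
       = (\<Union>i. {p \<in> FCF1_chart a u. chart_coords a u p \<in> A i})" by auto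
    then show ?case using Union by auto
  qed simp
qed

lemma FCF1_chart_in_sets: "cross2 a u \<noteq> 0 \<Longrightarrow> FCF1_chart a u \<in> sets FCF1_borel"
  using chart_coords_measurable[of a u UNIV] by simp

section \<open>The Moebius measure\<close>

definition chart_integral :: "real^2 \<Rightarrow> real^2 \<Rightarrow> ((real^2) set \<times> (real^2) set) set \<Rightarrow> ennreal" where
  "chart_integral a u S =
     (\<integral>\<^sup>+ z. ennreal (1 / (fst z - snd z)^2) * indicator {z. line_pair a u z \<in> S} z \<partial>lborel)"

lemma borel_measurable_kernel [measurable]:
  "(\<lambda>z :: real \<times> real. ennreal (1 / (fst z - snd z)^2)) \<in> borel_measurable borel"
proof -
  have [measurable]: "(fst :: real \<times> real \<Rightarrow> real) \<in> borel_measurable borel"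
    "(snd :: real \<times> real \<Rightarrow> real) \<in> borel_measurable borel"
    by (intro borel_measurable_continuous_onI continuous_intros)+
  show ?thesis by measurable
qed

text \<open>
  The invariance of the form. Let \<open>g s = (p + q s) / (r + t s)\<close> be the change from the chart \<open>a, u\<close> to
  the reference chart, the horizontal line at height one, and \<open>D\<close> its determinant. Then
  \<open>g s - g s'\<close> equals \<open>D (s - s') / ((r + t s) (r + t s'))\<close>, and \<open>g\<close> has derivative \<open>D / (r + t s)\<^sup>2\<close>
  at \<open>s\<close>; so the two derivatives at \<open>s\<close> and \<open>s'\<close> cancel against \<open>1 / (g s - g s')\<^sup>2\<close> up to
  \<open>1 / (s - s')\<^sup>2\<close>. The substitution is made in one variable after the other.
\<close>

lemma chart_integral_eq_base:
  assumes au: "cross2 a u \<noteq> 0" and S: "S \<in> sets FCF1_borel"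
  shows "chart_integral (vector [0, 1]) (vector [1, 0]) S = chart_integral a u S"
proof -
  define p q r t where "p = a $ 1" "q = u $ 1" "r = a $ 2" "t = u $ 2"
  note pqrt = p_q_r_t_def
  define g where "g = (\<lambda>s. (p + q * s) / (r + t * s))"
  define \<rho> where "\<rho> = (\<lambda>s. ennreal (\<bar>q * r - p * t\<bar> / (r + t * s)^2))"
  define H where "H = (\<lambda>z. ennreal (1 / (fst z - snd z)^2) *
      indicator {z. line_pair (vector [0, 1]) (vector [1, 0]) z \<in> S} z)"
  define K where "K = (\<lambda>z. ennreal (1 / (fst z - snd z)^2) * indicator {z. line_pair a u z \<in> S} z)"
  have D: "q * r - p * t \<noteq> 0" using au by (simp add: cross2_def pqrt algebra_simps)
  note [measurable] = borel_line_pair[OF S, of a u]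
    borel_line_pair[OF S, of "vector [0, 1]" "vector [1, 0]"]
  have [measurable]: "H \<in> borel_measurable borel" "K \<in> borel_measurable borel"
    "g \<in> borel_measurable borel" "\<rho> \<in> borel_measurable borel"
    unfolding H_def K_def g_def \<rho>_def by measurable
  have [measurable]: "H \<in> borel_measurable (lborel \<Otimes>\<^sub>M lborel)" "K \<in> borel_measurable (lborel \<Otimes>\<^sub>M lborel)"
    by (simp_all add: lborel_prod)
  \<comment> \<open>The pole is the coordinate of the line parallel to the reference line.\<close>
  have AE: "AE s in lborel. r + t * s \<noteq> 0"
  proof (rule AE_I[of _ _ "{- r / t}"])
    show "{s \<in> space lborel. \<not> r + t * s \<noteq> 0} \<subseteq> {- r / t}"
    proof
      fix s assume "s \<in> {s \<in> space lborel. \<not> r + t * s \<noteq> 0}"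
      then have s: "r + t * s = 0" by simp
      have "t \<noteq> 0" using D s by auto
      then show "s \<in> {- r / t}" using s by (simp add: field_simps)
    qed
  qed auto
  have span_g: "span {vector [0, 1] + g s *\<^sub>R vector [1, 0]} = span {a + s *\<^sub>R u}"
    if s: "r + t * s \<noteq> 0" for s
  proof -
    have "a + s *\<^sub>R u = (r + t * s) *\<^sub>R (vector [0, 1] + g s *\<^sub>R vector [1, 0] :: real^2)"
    proof -
      have "(r + t * s) * g s = p + q * s" using s by (simp add: g_def)
      then show ?thesis by (simp add: vec_eq_iff forall_2 pqrt mult.commute)
    qed
    then show ?thesis
      using span_image_scale[of "{vector [0, 1] + g s *\<^sub>R vector [1, 0] :: real^2}" "\<lambda>_. r + t * s"] s
      by simp
  qed
  have cancel: "\<bar>D\<bar> / A^2 * (\<bar>D\<bar> / B^2 * (1 / (D * d / (A * B))^2)) = 1 / d^2"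
    if "A \<noteq> 0" "B \<noteq> 0" "D \<noteq> 0" for A B D d :: real
  proof -
    have "\<bar>D\<bar> * (\<bar>D\<bar> * X) = D^2 * X" for X
      by (simp add: power2_eq_square flip: mult.assoc)
    then have "\<bar>D\<bar> / A^2 * (\<bar>D\<bar> / B^2 * (1 / (D * d / (A * B))^2)) = D^2 / (A^2 * B^2) * ((A * B)^2 / (D * d)^2)"
      by (simp add: power_divide mult.assoc)
    then show ?thesis using that by (simp add: power_mult_distrib)
  qed
  have point: "\<rho> s * (\<rho> s' * H (g s, g s')) = K (s, s')" if s: "r + t * s \<noteq> 0" "r + t * s' \<noteq> 0" for s s'
  proof -
    have ind: "indicator {z. line_pair (vector [0, 1]) (vector [1, 0]) z \<in> S} (g s, g s')
       = (indicator {z. line_pair a u z \<in> S} (s, s') :: ennreal)"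
      using span_g[OF s(1)] span_g[OF s(2)] by (simp add: line_pair_def indicator_def)
    have "g s - g s' = (q * r - p * t) * (s - s') / ((r + t * s) * (r + t * s'))"
      using s by (simp add: g_def diff_frac_eq) (simp add: algebra_simps)
    then have "\<bar>q * r - p * t\<bar> / (r + t * s)^2 * (\<bar>q * r - p * t\<bar> / (r + t * s')^2 * (1 / (g s - g s')^2))
       = 1 / (s - s')^2"
      by (simp only: cancel[OF s D])
    then show ?thesis
      by (simp add: H_def K_def ind \<rho>_def flip: ennreal_mult mult.assoc)
  qed
  have "chart_integral (vector [0, 1]) (vector [1, 0]) S = (\<integral>\<^sup>+ x. \<integral>\<^sup>+ y. H (x, y) \<partial>lborel \<partial>lborel)"
    unfolding chart_integral_def H_def[symmetric]
    by (simp add: lborel_prod[symmetric] lborel.nn_integral_fst)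
  also have "\<dots> = (\<integral>\<^sup>+ s. \<rho> s * (\<integral>\<^sup>+ y. H (g s, y) \<partial>lborel) \<partial>lborel)"
    unfolding \<rho>_def g_def by (rule nn_integral_moebius[OF D, symmetric]) measurable
  also have "\<dots> = (\<integral>\<^sup>+ s. \<rho> s * (\<integral>\<^sup>+ s'. \<rho> s' * H (g s, g s') \<partial>lborel) \<partial>lborel)"
    unfolding \<rho>_def g_def by (subst (2) nn_integral_moebius[OF D, symmetric]) simp_all
  also have "\<dots> = (\<integral>\<^sup>+ s. (\<integral>\<^sup>+ s'. \<rho> s * (\<rho> s' * H (g s, g s')) \<partial>lborel) \<partial>lborel)"
    by (simp add: nn_integral_cmult)
  also have "\<dots> = (\<integral>\<^sup>+ s. (\<integral>\<^sup>+ s'. K (s, s') \<partial>lborel) \<partial>lborel)"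
  proof (rule nn_integral_cong_AE, use AE in eventually_elim)
    fix s assume s: "r + t * s \<noteq> 0"
    show "(\<integral>\<^sup>+ s'. \<rho> s * (\<rho> s' * H (g s, g s')) \<partial>lborel) = (\<integral>\<^sup>+ s'. K (s, s') \<partial>lborel)"
      by (rule nn_integral_cong_AE, use AE in eventually_elim) (rule point[OF s])
  qed
  also have "\<dots> = chart_integral a u S"
    unfolding chart_integral_def K_def[symmetric]
    by (simp add: lborel_prod[symmetric] lborel.nn_integral_fst)
  finally show ?thesis .
qed

lemma chart_formula_eq_chart_integral:
  assumes "cross2 a u \<noteq> 0" "S \<subseteq> FCF1_chart a u"
  shows "(\<integral>\<^sup>+(x, y) \<in> chart_coords a u ` S. ennreal (1 / \<bar>x - y\<bar>^2) \<partial>lborel) = chart_integral a u S"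
  unfolding chart_coords_image[OF assms] chart_integral_def
  by (intro nn_integral_cong) (auto simp: split_beta)

text \<open>
  A pair of lines lies in a chart unless one of them is parallel to the coordinate line. Of three
  pairwise independent directions, two lines can exclude at most two.
\<close>

lemma FCF1_covered_by_charts:
  "\<exists>a u :: nat \<Rightarrow> real^2. (\<forall>i. norm (u i) = 1) \<and> (\<forall>i. cross2 (a i) (u i) \<noteq> 0) \<and>
     FCF1 \<subseteq> (\<Union>i<3. FCF1_chart (a i) (u i))"
proof -
  define w where "w = (\<lambda>i::nat. (if i = 0 then vector [1, 0] else if i = 1 then vector [0, 1] else vector [1, 1]) :: real^2)"
  define u where "u = (\<lambda>i. w i /\<^sub>R norm (w i))"
  define a where "a = (\<lambda>i::nat. (if i = 0 then vector [0, 1] else vector [1, 0]) :: real^2)"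
  have wnz: "w i \<noteq> 0" for i by (auto simp: w_def vec_eq_iff forall_2)
  have n: "norm (u i) = 1" for i using wnz[of i] by (simp add: u_def)
  have nz: "cross2 (a i) (u i) \<noteq> 0" for i
    using wnz[of i] by (auto simp: u_def a_def cross2_def w_def)
  have "FCF1 \<subseteq> (\<Union>i<3. FCF1_chart (a i) (u i))"
  proof
    fix p assume "p \<in> FCF1"
    then obtain v v' where p: "p = (span {v}, span {v'})" "cross2 v v' \<noteq> 0" by (rule FCF1_cases)
    have in_chart: "p \<in> FCF1_chart (a i) (u i) \<longleftrightarrow> cross2 v (w i) \<noteq> 0 \<and> cross2 v' (w i) \<noteq> 0" for i
      using p wnz[of i] unfolding p(1) FCF1_chart_iff[OF nz] by (simp add: u_def)
    have "\<exists>i\<in>{0, 1, 2}. cross2 v (w i) \<noteq> 0 \<and> cross2 v' (w i) \<noteq> 0"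
      using p(2) by (auto simp: cross2_def w_def)
    then show "p \<in> (\<Union>i<3. FCF1_chart (a i) (u i))" using in_chart by force
  qed
  then show ?thesis using n nz by (intro exI[of _ a] exI[of _ u]) simp
qed

text \<open>
  The definite description defining \<open>mu_omega1\<close> denotes: the push-forward of the density from the
  reference chart has the required property in every chart by \<open>chart_integral_eq_base\<close>, and the values
  in the charts determine a measure because three charts cover \<open>FCF1\<close>.
\<close>

lemma
  shows sets_mu_omega1: "sets mu_omega1 = sets FCF1_borel"
    and emeasure_mu_omega1: "\<And>a u S. norm u = 1 \<Longrightarrow> cross2 a u \<noteq> 0 \<Longrightarrow> S \<in> sets FCF1_borel \<Longrightarrow>
          S \<subseteq> FCF1_chart a u \<Longrightarrow> emeasure mu_omega1 S = chart_integral a u S"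
proof -
  define F where "F = (\<lambda>a u S. \<integral>\<^sup>+(x, y) \<in> chart_coords a u ` S. ennreal (1 / \<bar>x - y\<bar>^2) \<partial>lborel)"
  define P where "P = (\<lambda>M. space M = FCF1 \<and> sets M = sets FCF1_borel \<and>
     (\<forall>a u. norm u = 1 \<and> 0 \<notin> coord_line a u \<longrightarrow>
        (\<forall>S \<in> sets M. S \<subseteq> FCF1_chart a u \<longrightarrow> emeasure M S = F a u S)))"
  have F: "F a u S = chart_integral a u S" if "cross2 a u \<noteq> 0" "S \<subseteq> FCF1_chart a u" for a u S
    unfolding F_def by (rule chart_formula_eq_chart_integral[OF that])
  have P_iff: "P M \<longleftrightarrow> sets M = sets FCF1_borel \<and> (\<forall>a u. norm u = 1 \<and> cross2 a u \<noteq> 0 \<longrightarrow>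
      (\<forall>S \<in> sets FCF1_borel. S \<subseteq> FCF1_chart a u \<longrightarrow> emeasure M S = chart_integral a u S))" for M
  proof -
    have "sets M = sets FCF1_borel \<Longrightarrow> space M = FCF1"
      using sets_eq_imp_space_eq[of M FCF1_borel] by simp
    then show ?thesis unfolding P_def
      by (intro iffI conjI allI impI ballI; elim conjE) (metis F coord_line_avoids_0_iff)+
  qed
  have mu: "mu_omega1 = (THE M. P M)" by (simp add: mu_omega1_def P_def F_def)
  \<comment> \<open>The diagonal is removed so that the map takes its values in \<open>FCF1\<close>.\<close>
  define M0 where "M0 = distr (restrict_space (density lborel (\<lambda>z::real\<times>real. ennreal (1 / (fst z - snd z)^2)))
       {z. fst z \<noteq> snd z}) FCF1_borel (line_pair (vector [0, 1]) (vector [1, 0]))"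
  have base: "cross2 (vector [0, 1]) (vector [1, 0]) \<noteq> 0" by (simp add: cross2_def)
  have off: "{z :: real \<times> real. fst z \<noteq> snd z} \<in> sets borel"
    by (intro borel_open open_Collect_neq continuous_intros)
  have meas: "line_pair (vector [0, 1]) (vector [1, 0]) \<in>
     restrict_space (density lborel (\<lambda>z::real\<times>real. ennreal (1 / (fst z - snd z)^2))) {z. fst z \<noteq> snd z}
       \<rightarrow>\<^sub>M FCF1_borel"
  proof (rule measurableI)
    fix z assume "z \<in> space (restrict_space (density lborel (\<lambda>z::real\<times>real. ennreal (1 / (fst z - snd z)^2))) {z. fst z \<noteq> snd z})"
    then show "line_pair (vector [0, 1]) (vector [1, 0]) z \<in> space FCF1_borel"
      using line_pair_in_FCF1[OF base, of "fst z" "snd z"] by (simp add: space_restrict_space)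
  next
    fix A assume A: "A \<in> sets FCF1_borel"
    show "line_pair (vector [0, 1]) (vector [1, 0]) -` A \<inter>
       space (restrict_space (density lborel (\<lambda>z::real\<times>real. ennreal (1 / (fst z - snd z)^2))) {z. fst z \<noteq> snd z})
       \<in> sets (restrict_space (density lborel (\<lambda>z::real\<times>real. ennreal (1 / (fst z - snd z)^2))) {z. fst z \<noteq> snd z})"
      using borel_line_pair[OF A, of "vector [0, 1]" "vector [1, 0]"] off
      by (auto simp: space_restrict_space sets_restrict_space vimage_def)
  qed
  have M0: "emeasure M0 S = chart_integral (vector [0, 1]) (vector [1, 0]) S" if S: "S \<in> sets FCF1_borel" for S
  proof -
    have sub: "S \<subseteq> FCF1" using sets.sets_into_space[OF S] by simp
    define L where "L = {z. line_pair (vector [0, 1]) (vector [1, 0]) z \<in> S}"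
    have L: "L \<in> sets borel" unfolding L_def by (rule borel_line_pair[OF S])
    have L_sub: "L \<subseteq> {z. fst z \<noteq> snd z}"
      using sub line_pair_in_FCF1[OF base] by (auto simp: L_def)
    have eq: "line_pair (vector [0, 1]) (vector [1, 0]) -` S \<inter> {z. fst z \<noteq> snd z} = L"
      using L_sub by (auto simp: L_def)
    have "emeasure M0 S = emeasure (density lborel (\<lambda>z::real\<times>real. ennreal (1 / (fst z - snd z)^2))) L"
    proof -
      have "emeasure M0 S = emeasure (restrict_space (density lborel (\<lambda>z::real\<times>real. ennreal (1 / (fst z - snd z)^2)))
          {z. fst z \<noteq> snd z}) L"
        unfolding M0_def by (subst emeasure_distr[OF meas S]) (simp only: space_restrict_space space_density space_lborel space_borel Int_UNIV_right eq)
      also have "\<dots> = emeasure (density lborel (\<lambda>z::real\<times>real. ennreal (1 / (fst z - snd z)^2))) L"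
        by (rule emeasure_restrict_space[OF _ L_sub])
           (simp only: off space_density space_lborel space_borel Int_UNIV_right sets_density sets_lborel)
      finally show ?thesis .
    qed
    also have "\<dots> = chart_integral (vector [0, 1]) (vector [1, 0]) S"
      unfolding chart_integral_def L_def[symmetric]
      by (rule emeasure_density) (simp_all only: measurable_lborel2 sets_lborel borel_measurable_kernel L)
    finally show ?thesis .
  qed
  have "P M0" unfolding P_iff using M0 chart_integral_eq_base by (simp add: M0_def)
  moreover have "M = M'" if M: "P M" and M': "P M'" for M M'
  proof (rule measure_eqI)
    show sets: "sets M = sets M'" using M M' by (simp add: P_iff)
    fix S assume "S \<in> sets M"
    then have S: "S \<in> sets FCF1_borel" using M by (simp add: P_iff)
    obtain a u :: "nat \<Rightarrow> real^2" where charts: "(\<forall>i. norm (u i) = 1) \<and>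
        (\<forall>i. cross2 (a i) (u i) \<noteq> 0) \<and> FCF1 \<subseteq> (\<Union>i<3. FCF1_chart (a i) (u i))"
      using FCF1_covered_by_charts by (elim exE)
    then have au: "norm (u i) = 1" "cross2 (a i) (u i) \<noteq> 0" for i by simp_all
    have cover: "FCF1 \<subseteq> (\<Union>i<3. FCF1_chart (a i) (u i))" using charts by simp
    \<comment> \<open>Cut \<open>S\<close> into disjoint pieces, each contained in a single chart.\<close>
    define T where "T = (\<lambda>i. S \<inter> disjointed (\<lambda>i. FCF1_chart (a i) (u i)) i)"
    have T: "T i \<in> sets FCF1_borel" "T i \<subseteq> FCF1_chart (a i) (u i)" for i
      using S sets.range_disjointed_sets[of "\<lambda>i. FCF1_chart (a i) (u i)" FCF1_borel]
        FCF1_chart_in_sets[OF au(2)] disjointed_subset[of "\<lambda>i. FCF1_chart (a i) (u i)" i]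
      by (auto simp: T_def)
    have disj: "disjoint_family T"
      using disjoint_family_disjointed[of "\<lambda>i. FCF1_chart (a i) (u i)"]
      by (auto simp: T_def disjoint_family_on_def)
    have "S \<subseteq> (\<Union>i. FCF1_chart (a i) (u i))"
      using cover sets.sets_into_space[OF S] unfolding space_FCF1_borel by blast
    then have ST: "S = (\<Union>i. T i)"
      using UN_disjointed_eq[of "\<lambda>i. FCF1_chart (a i) (u i)"] by (auto simp: T_def)
    have *: "emeasure N S = (\<Sum>i. chart_integral (a i) (u i) (T i))" if "P N" for N
    proof -
      have "emeasure N S = (\<Sum>i. emeasure N (T i))"
        unfolding ST using T that by (intro suminf_emeasure[symmetric] disj) (auto simp: P_iff)
      moreover have "emeasure N (T i) = chart_integral (a i) (u i) (T i)" for i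
        using that T[of i] au[of i] unfolding P_iff by blast
      ultimately show ?thesis by simp
    qed
    show "emeasure M S = emeasure M' S" using *[OF M] *[OF M'] by simp
  qed
  ultimately have "P mu_omega1" unfolding mu by (intro theI[of P M0]; blast)
  then show "sets mu_omega1 = sets FCF1_borel"
    "\<And>a u S. norm u = 1 \<Longrightarrow> cross2 a u \<noteq> 0 \<Longrightarrow> S \<in> sets FCF1_borel \<Longrightarrow>
          S \<subseteq> FCF1_chart a u \<Longrightarrow> emeasure mu_omega1 S = chart_integral a u S"
    unfolding P_iff by auto
qed

section \<open>The cones cut out by two lines\<close>

text \<open>
  The cone of positive combinations of \<open>v\<close> and \<open>w\<close>, described by its coordinates in the basis
  \<open>(v, w)\<close>. Dividing by \<open>cross2 v w\<close> makes it independent of the orientation of the basis.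
\<close>

definition wedge :: "real^2 \<Rightarrow> real^2 \<Rightarrow> (real^2) set" where
  "wedge v w = {z. 0 < cross2 z w / cross2 v w \<and> 0 < cross2 v z / cross2 v w}"

definition closed_wedge :: "real^2 \<Rightarrow> real^2 \<Rightarrow> (real^2) set" where
  "closed_wedge v w = {z. 0 \<le> cross2 z w / cross2 v w \<and> 0 \<le> cross2 v z / cross2 v w}"

lemma continuous_on_cross2_quotient [continuous_intros]:
  "continuous_on S (\<lambda>z. cross2 z w / c)" "continuous_on S (\<lambda>z. cross2 v z / c)"
  unfolding divide_inverse by (intro continuous_intros)+

lemma convex_wedge: "convex (wedge v w)"
proof -
  have "0 < (\<alpha> * p + \<beta> * q) / c" if "0 < p / c" "0 < q / c" "0 \<le> \<alpha>" "0 \<le> \<beta>" "\<alpha> + \<beta> = 1"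
    for \<alpha> \<beta> p q c :: real
  proof -
    have "0 < \<alpha> * (p / c) + \<beta> * (q / c)"
    proof (cases "\<alpha> = 0")
      case True then show ?thesis using that by simp
    next
      case False then show ?thesis using that by (intro add_pos_nonneg mult_pos_pos mult_nonneg_nonneg) auto
    qed
    then show ?thesis by (simp add: add_divide_distrib)
  qed
  then show ?thesis unfolding convex_def wedge_def by simp
qed

lemma closure_wedge:
  assumes vw: "cross2 v w \<noteq> 0"
  shows "closure (wedge v w) = closed_wedge v w"
proof
  have "closed (closed_wedge v w)" unfolding closed_wedge_def
    by (intro closed_Collect_conj closed_Collect_le continuous_intros)
  then show "closure (wedge v w) \<subseteq> closed_wedge v w"
    by (intro closure_minimal) (auto simp: wedge_def closed_wedge_def)
  show "closed_wedge v w \<subseteq> closure (wedge v w)"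
  proof
    fix z assume z: "z \<in> closed_wedge v w"
    \<comment> \<open>Moving a boundary point in the direction \<open>v + w\<close> leads into the open cone.\<close>
    define h where "h = (\<lambda>n. z + (1 / (real n + 1)) *\<^sub>R (v + w))"
    have "h n \<in> wedge v w" for n
    proof -
      have "cross2 (h n) w / cross2 v w = cross2 z w / cross2 v w + 1 / (real n + 1)"
        "cross2 v (h n) / cross2 v w = cross2 v z / cross2 v w + 1 / (real n + 1)"
        using vw by (simp_all add: h_def add_divide_distrib)
      moreover have "0 < 1 / (real n + 1)" by simp
      ultimately show ?thesis using z unfolding wedge_def closed_wedge_def mem_Collect_eq by linarith
    qed
    moreover have "h \<longlonglongrightarrow> z + 0 *\<^sub>R (v + w)"
      unfolding h_def
      by (intro tendsto_intros) (use LIMSEQ_inverse_real_of_nat in \<open>simp add: inverse_eq_divide add.commute\<close>)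
    ultimately show "z \<in> closure (wedge v w)" unfolding closure_sequential by auto
  qed
qed

lemma connected_nonzero_same_sign:
  fixes f :: "'a::topological_space \<Rightarrow> real"
  assumes "connected T" "continuous_on T f" "\<And>x. x \<in> T \<Longrightarrow> f x \<noteq> 0" "z \<in> T" "0 < f z" "y \<in> T"
  shows "0 < f y"
proof (rule ccontr)
  assume "\<not> 0 < f y"
  moreover have "connected (f ` T)" using assms by (intro connected_continuous_image)
  ultimately have "0 \<in> f ` T" using connectedD_interval[of "f ` T" "f y" "f z" 0] assms by auto
  then show False using assms by auto
qed

text \<open>
  A cone is convex, hence connected; conversely the two coordinates have no zero off the two lines, so
  on a connected set they keep their signs.
\<close>

lemma connected_component_wedge:
  assumes vw: "cross2 v w \<noteq> 0" and z: "z \<in> wedge v w"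
  shows "connected_component_set (- (span {v} \<union> span {w})) z = wedge v w"
proof
  have nz: "v \<noteq> 0" "w \<noteq> 0" using vw by auto
  have S: "y \<in> - (span {v} \<union> span {w}) \<longleftrightarrow> cross2 y w \<noteq> 0 \<and> cross2 v y \<noteq> 0" for y
    using cross2_eq_0_iff[OF nz(1), of y] cross2_eq_0_iff[OF nz(2), of y] cross2_commute[of v y] by auto
  have sub: "wedge v w \<subseteq> - (span {v} \<union> span {w})"
  proof
    fix y assume "y \<in> wedge v w"
    then have "cross2 y w \<noteq> 0" "cross2 v y \<noteq> 0" by (auto simp: wedge_def)
    then show "y \<in> - (span {v} \<union> span {w})" unfolding S by blast
  qed
  show "wedge v w \<subseteq> connected_component_set (- (span {v} \<union> span {w})) z"
    by (rule connected_component_maximal[OF z convex_connected[OF convex_wedge] sub])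
  define T where "T = connected_component_set (- (span {v} \<union> span {w})) z"
  have T: "connected T" "T \<subseteq> - (span {v} \<union> span {w})" "z \<in> T"
  proof -
    show "connected T" "T \<subseteq> - (span {v} \<union> span {w})"
      unfolding T_def by (rule connected_connected_component, rule connected_component_subset)
    have "z \<in> - (span {v} \<union> span {w})" using sub z by (rule subsetD)
    then show "z \<in> T" unfolding T_def by (simp only: mem_Collect_eq connected_component_refl_eq)
  qed
  have nzT: "cross2 x w / cross2 v w \<noteq> 0" "cross2 v x / cross2 v w \<noteq> 0" if "x \<in> T" for x
  proof -
    have "x \<in> - (span {v} \<union> span {w})" using T(2) that by (rule subsetD)
    then show "cross2 x w / cross2 v w \<noteq> 0" "cross2 v x / cross2 v w \<noteq> 0"
      unfolding S using vw by simp_all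
  qed
  show "T \<subseteq> wedge v w"
  proof
    fix y assume y: "y \<in> T"
    have "0 < cross2 y w / cross2 v w"
      by (rule connected_nonzero_same_sign[OF T(1) continuous_on_cross2_quotient(1) _ T(3) _ y])
         (use z nzT in \<open>auto simp: wedge_def\<close>)
    moreover have "0 < cross2 v y / cross2 v w"
      by (rule connected_nonzero_same_sign[OF T(1) continuous_on_cross2_quotient(2) _ T(3) _ y])
         (use z nzT in \<open>auto simp: wedge_def\<close>)
    ultimately show "y \<in> wedge v w" by (simp add: wedge_def)
  qed
qed

lemma wedge_in_open_cones:
  assumes vw: "cross2 v w \<noteq> 0"
  shows "wedge v w \<in> open_cones {span {v}, span {w}}"
proof -
  have z: "v + w \<in> wedge v w" using vw by (simp add: wedge_def)
  have "v + w \<in> - (span {v} \<union> span {w})"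
    using connected_component_wedge[OF vw z] z
    by (metis connected_component_in mem_Collect_eq)
  then show ?thesis unfolding open_cones_def components_iff
    using connected_component_wedge[OF vw z] by auto
qed

lemma span_sing_scale: "c \<noteq> 0 \<Longrightarrow> span {c *\<^sub>R v} = span {v :: real^2}"
  by (cases "v = 0") (simp_all add: span_sing_eq_iff)

text \<open>
  Scaling \<open>v\<close> and \<open>w\<close> by the coordinates of a point of the cone gives it coordinates \<open>(1, 1)\<close>
  without changing the lines, so all four cones are of the form \<open>wedge v' w'\<close>.
\<close>

lemma open_cones_cases:
  assumes vw: "cross2 v w \<noteq> 0" and C: "C \<in> open_cones {span {v}, span {w}}"
  obtains v' w' where "span {v'} = span {v}" "span {w'} = span {w}" "cross2 v' w' \<noteq> 0" "C = wedge v' w'"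
proof -
  have nz: "v \<noteq> 0" "w \<noteq> 0" using vw by auto
  obtain z where z: "z \<in> - (span {v} \<union> span {w})"
    and Cz: "C = connected_component_set (- (span {v} \<union> span {w})) z"
    using C by (auto simp: open_cones_def components_iff)
  define p q where "p = cross2 z w / cross2 v w" and "q = cross2 v z / cross2 v w"
  have pq: "p \<noteq> 0" "q \<noteq> 0"
    using z cross2_eq_0_iff[OF nz(1), of z] cross2_eq_0_iff[OF nz(2), of z] cross2_commute[of v z] vw
    by (auto simp: p_def q_def)
  define v' w' where "v' = p *\<^sub>R v" and "w' = q *\<^sub>R w"
  have sp: "span {v'} = span {v}" "span {w'} = span {w}"
    using pq by (simp_all add: v'_def w'_def span_sing_scale)
  have vw': "cross2 v' w' \<noteq> 0" using pq vw by (simp add: v'_def w'_def)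
  have "cross2 z w' / cross2 v' w' = 1" "cross2 v' z / cross2 v' w' = 1"
    using pq vw by (simp_all add: v'_def w'_def) (simp_all add: p_def q_def)
  then have "z \<in> wedge v' w'" by (simp add: wedge_def)
  then have "C = wedge v' w'" using connected_component_wedge[OF vw'] Cz sp by simp
  then show ?thesis using that sp vw' by blast
qed

section \<open>Continued fractions with a given edge\<close>

lemma int_points_iff: "z \<in> int_points \<longleftrightarrow> z $ 1 \<in> \<int> \<and> z $ 2 \<in> \<int>"
  by (simp add: int_points_def forall_2)

lemma cross2_int: "z \<in> int_points \<Longrightarrow> z' \<in> int_points \<Longrightarrow> cross2 z z' \<in> \<int>"
  by (simp add: int_points_iff cross2_def)

lemma int_points_closed:
  "z \<in> int_points \<Longrightarrow> z' \<in> int_points \<Longrightarrow> z + z' \<in> int_points"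
  "z \<in> int_points \<Longrightarrow> z' \<in> int_points \<Longrightarrow> z - z' \<in> int_points"
  "c \<in> \<int> \<Longrightarrow> z \<in> int_points \<Longrightarrow> c *\<^sub>R z \<in> int_points"
  by (auto simp: int_points_iff)

lemma on_line_segment_iff:
  fixes a e :: "real^2"
  assumes "e \<noteq> 0" "k > 0"
  shows "a + t *\<^sub>R e \<in> closed_segment a (a + k *\<^sub>R e) \<longleftrightarrow> 0 \<le> t \<and> t \<le> k"
proof
  assume "a + t *\<^sub>R e \<in> closed_segment a (a + k *\<^sub>R e)"
  then obtain s where s: "0 \<le> s" "s \<le> 1" "a + t *\<^sub>R e = (1 - s) *\<^sub>R a + s *\<^sub>R (a + k *\<^sub>R e)"
    by (auto simp: in_segment)
  then have "t *\<^sub>R e = (s * k) *\<^sub>R e" by (simp add: algebra_simps)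
  then have "t = s * k" using assms by simp
  then show "0 \<le> t \<and> t \<le> k" using s assms by (auto intro: mult_left_le_one_le)
next
  assume t: "0 \<le> t \<and> t \<le> k"
  have "a + t *\<^sub>R e = (1 - t / k) *\<^sub>R a + (t / k) *\<^sub>R (a + k *\<^sub>R e)"
    using assms by (simp add: algebra_simps)
  then show "a + t *\<^sub>R e \<in> closed_segment a (a + k *\<^sub>R e)"
    unfolding in_segment using t assms by (intro exI[of _ "t / k"]) simp
qed

text \<open>
  A segment from \<open>a\<close> to \<open>a + k e\<close> at unit integer distance from the origin: the matrix of \<open>a\<close> and
  \<open>e\<close> is unimodular.
\<close>

locale integer_basis =
  fixes a e :: "real^2" and k :: nat
  assumes a_int: "a \<in> int_points" and e_int: "e \<in> int_points"
    and unimodular: "\<bar>cross2 a e\<bar> = 1" and k_pos: "k > 0"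
begin

abbreviation "b \<equiv> a + real k *\<^sub>R e"

text \<open>
  The coordinate along \<open>a\<close> in the basis \<open>(a, e)\<close>. It is integral on integer points, and it equals one
  exactly on the line carrying the segment.
\<close>

definition height :: "real^2 \<Rightarrow> real" where "height z = cross2 z e / cross2 a e"

lemma cross_nz: "cross2 a e \<noteq> 0" using unimodular by auto

lemma e_nz: "e \<noteq> 0" using cross_nz by auto

lemma b_int: "b \<in> int_points"
  using a_int e_int by (intro int_points_closed) auto

lemma height_simps [simp]:
  "height (z + z') = height z + height z'" "height (c *\<^sub>R z) = c * height z" "height a = 1" "height e = 0"
  using cross_nz by (simp_all add: height_def add_divide_distrib)

lemma height_int:
  assumes "z \<in> int_points"
  shows "height z \<in> \<int>"
proof -
  have "cross2 a e = 1 \<or> cross2 a e = -1" using unimodular by linarith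
  then show ?thesis using cross2_int[OF assms e_int] by (auto simp: height_def)
qed

lemma height_one:
  assumes "height z = 1"
  obtains t where "z = a + t *\<^sub>R e" "z \<in> int_points \<longrightarrow> t \<in> \<int>"
proof
  have *: "cross2 z e = cross2 a e" using assms cross_nz by (simp add: height_def)
  define t where "t = cross2 a z / cross2 a e"
  have "cross2 a e *\<^sub>R z = cross2 a e *\<^sub>R (a + t *\<^sub>R e)"
    using cross2_expand[of a e z] * cross_nz by (simp add: t_def scaleR_add_right)
  then show "z = a + t *\<^sub>R e" using cross_nz by simp
  have "cross2 a e = 1 \<or> cross2 a e = -1" using unimodular by linarith
  then show "z \<in> int_points \<longrightarrow> t \<in> \<int>" using cross2_int[OF a_int, of z] by (auto simp: t_def)
qed

text \<open>
  The cone between the rays through \<open>a + x e\<close> and \<open>a + y e\<close>, with \<open>x\<close> in the unit interval ending at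
  the start of the segment and \<open>y\<close> in the unit interval beginning at its end.
\<close>

context
  fixes x y :: real
  assumes x: "-1 < x" "x \<le> 0" and y: "real k \<le> y" "y < real k + 1"
begin

lemma cross_vw: "cross2 (a + x *\<^sub>R e) (a + y *\<^sub>R e) = (y - x) * cross2 a e"
  using cross2_commute[of e a] by (simp add: algebra_simps)

lemma xy: "x < y" using x y k_pos by linarith

lemma cross_vw_nz: "cross2 (a + x *\<^sub>R e) (a + y *\<^sub>R e) \<noteq> 0"
  using cross_vw xy cross_nz by simp

lemma line_in_closed_wedge:
  "a + t *\<^sub>R e \<in> closed_wedge (a + x *\<^sub>R e) (a + y *\<^sub>R e) \<longleftrightarrow> x \<le> t \<and> t \<le> y"
proof -
  have "cross2 (a + t *\<^sub>R e) (a + y *\<^sub>R e) = (y - t) * cross2 a e"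
    "cross2 (a + x *\<^sub>R e) (a + t *\<^sub>R e) = (t - x) * cross2 a e"
    using cross2_commute[of e a] by (simp_all add: algebra_simps)
  then show ?thesis unfolding closed_wedge_def mem_Collect_eq cross_vw
    using xy cross_nz by (auto simp: zero_le_divide_iff)
qed

lemma height_closed_wedge:
  assumes z: "z \<in> closed_wedge (a + x *\<^sub>R e) (a + y *\<^sub>R e)" "z \<noteq> 0"
  shows "height z > 0"
proof -
  define v w where "v = a + x *\<^sub>R e" and "w = a + y *\<^sub>R e"
  define p q where "p = cross2 z w / cross2 v w" and "q = cross2 v z / cross2 v w"
  have nz: "cross2 v w \<noteq> 0" using cross_vw_nz by (simp add: v_def w_def)
  have "cross2 v w *\<^sub>R z = cross2 v w *\<^sub>R (p *\<^sub>R v + q *\<^sub>R w)"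
    using cross2_expand[of v w z] nz by (simp add: p_def q_def scaleR_add_right)
  then have zpq: "z = p *\<^sub>R v + q *\<^sub>R w" using nz by simp
  have "height z = p + q" unfolding zpq by (simp add: v_def w_def)
  moreover have "0 \<le> p" "0 \<le> q" using z by (auto simp: closed_wedge_def p_def q_def v_def w_def)
  moreover have "p \<noteq> 0 \<or> q \<noteq> 0" using zpq z by auto
  ultimately show ?thesis by linarith
qed

text \<open>
  All nonzero integer points of the cone have height at least one, and those of height one are the
  integer points of the segment. Hence the line of height one supports the hull and touches it exactly
  in the segment.
\<close>

lemma segment_edge_of_hull:
  defines "H \<equiv> cone_hull (wedge (a + x *\<^sub>R e) (a + y *\<^sub>R e))"
  shows "closed_segment a b edge_of H" "closed_segment a b \<subseteq> frontier H"
proof -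
  define S where "S = closed_wedge (a + x *\<^sub>R e) (a + y *\<^sub>R e) \<inter> int_points - {0}"
  have H: "H = convex hull S"
    unfolding H_def cone_hull_def S_def closure_wedge[OF cross_vw_nz] ..
  have height_S: "height z \<ge> 1" if "z \<in> S" for z
  proof -
    have "height z > 0" using that height_closed_wedge by (auto simp: S_def)
    moreover have "height z \<in> \<int>" using that height_int by (auto simp: S_def)
    ultimately show ?thesis by (metis Ints_cases of_int_0_less_iff of_int_1_le_iff int_one_le_iff_zero_less)
  qed
  \<comment> \<open>A convex set that contains the integer points of the cone and meets the line of height one only
      in the segment.\<close>
  define Q where "Q = {z. height z > 1} \<union> closed_segment a b"
  have seg1: "height z = 1" if "z \<in> closed_segment a b" for z
    using that by (auto simp: in_segment algebra_simps)
  have "convex Q"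
  proof (rule convexI)
    fix z z' and s t :: real
    assume zz: "z \<in> Q" "z' \<in> Q" and st: "0 \<le> s" "0 \<le> t" "s + t = 1"
    have ge: "height z \<ge> 1" "height z' \<ge> 1" using zz seg1 unfolding Q_def by force+
    show "s *\<^sub>R z + t *\<^sub>R z' \<in> Q"
    proof (cases "height (s *\<^sub>R z + t *\<^sub>R z') > 1")
      case True
      then show ?thesis by (simp add: Q_def)
    next
      case False
      have "s * 1 \<le> s * height z" "t * 1 \<le> t * height z'"
        using ge st by (auto intro!: mult_left_mono simp del: mult_1_right)
      moreover have "s * height z + t * height z' \<le> 1" using False by simp
      ultimately have "s * height z = s" "t * height z' = t"
        using st unfolding mult_1_right by linarith+
      then have "s = 0 \<or> height z = 1" "t = 0 \<or> height z' = 1" by auto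
      moreover have "z \<in> closed_segment a b" if "height z = 1" using that zz by (auto simp: Q_def)
      moreover have "z' \<in> closed_segment a b" if "height z' = 1" using that zz by (auto simp: Q_def)
      ultimately have "s *\<^sub>R z + t *\<^sub>R z' \<in> closed_segment a b"
        using st convexD[OF convex_closed_segment[of a b], of z z' s t] by auto
      then show ?thesis by (simp add: Q_def)
    qed
  qed
  moreover have "S \<subseteq> Q"
  proof
    fix z assume z: "z \<in> S"
    show "z \<in> Q"
    proof (cases "height z = 1")
      case True
      then obtain t where t: "z = a + t *\<^sub>R e" "z \<in> int_points \<longrightarrow> t \<in> \<int>" by (rule height_one)
      then have "x \<le> t" "t \<le> y" "t \<in> \<int>" using z line_in_closed_wedge by (auto simp: S_def)
      moreover from this obtain j where "t = of_int j" by (auto elim: Ints_cases)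
      ultimately have "-1 < (of_int j :: real)" "of_int j < real k + 1" using x y by linarith+
      then have "0 \<le> j" "j \<le> int k" by linarith+
      then have "0 \<le> t" "t \<le> real k" using \<open>t = of_int j\<close> by auto
      then show ?thesis using on_line_segment_iff[OF e_nz, of "real k" a t] k_pos t by (auto simp: Q_def)
    next
      case False
      then show ?thesis using height_S[OF z] by (auto simp: Q_def)
    qed
  qed
  ultimately have HQ: "H \<subseteq> Q" unfolding H by (intro hull_minimal)
  have ab_S: "a \<in> S" "b \<in> S"
  proof -
    have "a + 0 *\<^sub>R e \<in> closed_wedge (a + x *\<^sub>R e) (a + y *\<^sub>R e)" "b \<in> closed_wedge (a + x *\<^sub>R e) (a + y *\<^sub>R e)"
      unfolding line_in_closed_wedge using x y by auto
    moreover have "height 0 = 0" by (simp add: height_def)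
    then have "a \<noteq> 0" "b \<noteq> 0" using height_simps by (metis zero_neq_one, metis add.right_neutral mult_zero_right zero_neq_one)
    ultimately show "a \<in> S" "b \<in> S" using a_int b_int by (auto simp: S_def)
  qed
  have conv: "convex H" unfolding H by simp
  have seg_H: "closed_segment a b \<subseteq> H"
    using ab_S unfolding H by (intro closed_segment_subset) (auto intro: hull_inc)
  \<comment> \<open>The vector representing the linear form \<open>height\<close>.\<close>
  define c :: "real^2" where "c = (\<chi> i. if i = 1 then e $ 2 / cross2 a e else - e $ 1 / cross2 a e)"
  have c: "c \<bullet> z = height z" for z
    by (simp add: c_def height_def inner_vec_def sum_2 cross2_def diff_divide_distrib mult.commute)
  have "H \<inter> {z. c \<bullet> z = 1} = closed_segment a b"
    using HQ seg1 seg_H by (auto simp: c Q_def)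
  moreover have "(H \<inter> {z. c \<bullet> z = 1}) face_of H"
    by (rule face_of_Int_supporting_hyperplane_ge[OF conv]) (use HQ seg1 in \<open>force simp: c Q_def\<close>)
  ultimately have "closed_segment a b face_of H" by simp
  moreover have "aff_dim (closed_segment a b) = 1"
    using e_nz k_pos by (simp add: segment_convex_hull aff_dim_convex_hull aff_dim_2)
  ultimately show "closed_segment a b edge_of H" by (simp add: edge_of_def)
  show "closed_segment a b \<subseteq> frontier H"
  proof
    fix z assume z: "z \<in> closed_segment a b"
    have "z \<notin> interior H"
    proof
      assume "z \<in> interior H"
      then obtain r where r: "r > 0" "ball z r \<subseteq> H" using mem_interior by blast
      \<comment> \<open>A nearby point of height less than one.\<close>
      define z' where "z' = z - (r / (2 * norm a)) *\<^sub>R a"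
      have "height 0 = 0" by (simp add: height_def)
      then have "a \<noteq> 0" using height_simps(3) by (metis zero_neq_one)
      then have an: "norm a > 0" by simp
      have "dist z z' = r / 2" using an r by (simp add: z'_def dist_norm)
      then have "z' \<in> H" using r by auto
      then have "height z' \<ge> 1" using HQ seg1 by (force simp: Q_def)
      moreover have "height z' = 1 - r / (2 * norm a)"
      proof -
        have "z' = z + (- (r / (2 * norm a))) *\<^sub>R a" by (simp add: z'_def)
        then have "height z' = height z + (- (r / (2 * norm a))) * height a" by (simp only: height_simps)
        then show ?thesis using seg1[OF z] by simp
      qed
      moreover have "r / (2 * norm a) > 0" using r an by simp
      ultimately show False by linarith
    qed
    then show "z \<in> frontier H" using z seg_H closure_subset by (auto simp: frontier_def)
  qed
qed

end

text \<open>
  The endpoints of an edge are extreme points of the hull, hence integer points of the closed cone. The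
  neighbours \<open>a - e\<close> and \<open>b + e\<close> cannot lie in the closed cone, since then the edge would have
  to reach as far as them. So both boundary rays cross the line of the segment, one in the last unit
  step before \<open>a\<close> and the other in the first unit step after \<open>b\<close>.
\<close>

lemma edge_of_hull_lines:
  assumes vw: "cross2 v w \<noteq> 0" and edge: "closed_segment a b edge_of cone_hull (wedge v w)"
  shows "\<exists>x y. -1 < x \<and> x \<le> 0 \<and> real k \<le> y \<and> y < real k + 1 \<and>
     {span {v}, span {w}} = {span {a + x *\<^sub>R e}, span {a + y *\<^sub>R e}}"
proof -
  define S where "S = closed_wedge v w \<inter> int_points - {0}"
  define H where "H = convex hull S"
  have face: "closed_segment a b face_of H"
    using edge unfolding edge_of_def cone_hull_def closure_wedge[OF vw] H_def S_def by simp
  have ab: "a \<in> S" "b \<in> S"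
    using face unfolding H_def
    by (metis extreme_point_of_convex_hull extreme_point_of_face extreme_point_of_segment)+
  have SH: "z \<in> H" if "z \<in> S" for z using that by (simp add: H_def hull_inc)
  have ends: "a - e \<notin> closed_wedge v w" "b + e \<notin> closed_wedge v w"
  proof -
    have nz: "a - e \<noteq> 0" "b + e \<noteq> 0"
    proof -
      have "height (a + (-1) *\<^sub>R e) = 1" "height (b + e) = 1" "height 0 = 0"
        unfolding height_simps by (simp_all add: height_def)
      then show "a - e \<noteq> 0" "b + e \<noteq> 0" by (metis scaleR_minus1_left diff_conv_add_uminus zero_neq_one)+
    qed
    have kk: "real k > 0" using k_pos by simp
    show "a - e \<notin> closed_wedge v w"
    proof
      assume "a - e \<in> closed_wedge v w"
      then have "a - e \<in> S" using nz a_int e_int by (auto simp: S_def int_points_closed)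
      then have "a - e \<in> H" "b \<in> H" using SH ab by auto
      moreover have "a \<in> open_segment (a - e) b"
      proof -
        have "a = (1 - 1 / (real k + 1)) *\<^sub>R (a - e) + (1 / (real k + 1)) *\<^sub>R b"
        proof -
          have "- (1 - 1 / (real k + 1)) + (1 / (real k + 1)) * real k = 0"
            by (simp add: field_simps)
          then have "(- (1 - 1 / (real k + 1)) + (1 / (real k + 1)) * real k) *\<^sub>R e = 0" by simp
          then show ?thesis by (simp add: algebra_simps)
        qed
        moreover have "a - e \<noteq> b"
        proof
          assume "a - e = b"
          then have "(real k + 1) *\<^sub>R e = 0" by (simp add: algebra_simps)
          then show False using e_nz by simp
        qed
        ultimately show ?thesis unfolding in_segment using kk by (intro conjI exI[of _ "1 / (real k + 1)"]) auto
      qed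
      ultimately have "a - e \<in> closed_segment a b"
        using face unfolding face_of_def by (meson ends_in_segment)
      then have "a + (-1) *\<^sub>R e \<in> closed_segment a b" by simp
      then show False unfolding on_line_segment_iff[OF e_nz kk] by simp
    qed
    show "b + e \<notin> closed_wedge v w"
    proof
      assume "b + e \<in> closed_wedge v w"
      then have "b + e \<in> S" using nz b_int e_int by (auto simp: S_def int_points_closed)
      then have "b + e \<in> H" "a \<in> H" using SH ab by auto
      moreover have "b \<in> open_segment a (b + e)"
      proof -
        have "b = (1 - real k / (real k + 1)) *\<^sub>R a + (real k / (real k + 1)) *\<^sub>R (b + e)"
        proof -
          define r where "r = real k / (real k + 1)"
          have "r * (real k + 1) = real k" by (simp add: r_def)
          then have "r + r * real k = real k" by (simp add: algebra_simps)
          then have "(r + r * real k) *\<^sub>R e = real k *\<^sub>R e" by simp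
          then show ?thesis unfolding r_def[symmetric] by (simp add: algebra_simps)
        qed
        moreover have "a \<noteq> b + e"
        proof
          assume "a = b + e"
          then have "(real k + 1) *\<^sub>R e = 0" by (simp add: algebra_simps)
          then show False using e_nz by simp
        qed
        ultimately show ?thesis unfolding in_segment using kk by (intro conjI exI[of _ "real k / (real k + 1)"]) auto
      qed
      ultimately have "b + e \<in> closed_segment a b"
        using face unfolding face_of_def by (meson ends_in_segment)
      then have "a + (real k + 1) *\<^sub>R e \<in> closed_segment a b" by (simp add: algebra_simps)
      then show False unfolding on_line_segment_iff[OF e_nz kk] by simp
    qed
  qed
  define p q where "p = (\<lambda>z. cross2 z w / cross2 v w)" and "q = (\<lambda>z. cross2 v z / cross2 v w)"
  have lin: "p (z + t *\<^sub>R e) = p z + t * p e" "q (z + t *\<^sub>R e) = q z + t * q e" for z t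
    by (simp_all add: p_def q_def add_divide_distrib)
  have cw: "z \<in> closed_wedge v w \<longleftrightarrow> 0 \<le> p z \<and> 0 \<le> q z" for z
    by (simp add: closed_wedge_def p_def q_def)
  have vw_nz: "v \<noteq> 0" "w \<noteq> 0" using vw by auto
  have on_w: "a + t *\<^sub>R e \<in> span {w}" if "p (a + t *\<^sub>R e) = 0" for t
    using that vw cross2_eq_0_iff[OF vw_nz(2), of "a + t *\<^sub>R e"] by (auto simp: p_def)
  have on_v: "a + t *\<^sub>R e \<in> span {v}" if "q (a + t *\<^sub>R e) = 0" for t
    using that vw cross2_eq_0_iff[OF vw_nz(1), of "a + t *\<^sub>R e"] cross2_commute[of v "a + t *\<^sub>R e"]
    by (auto simp: q_def)
  have same: "span {a + t *\<^sub>R e} = span {z}" if "a + t *\<^sub>R e \<in> span {z}" "z \<noteq> 0" for t z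
  proof -
    have "cross2 (a + t *\<^sub>R e) e \<noteq> 0" using cross_nz by simp
    then have "a + t *\<^sub>R e \<noteq> 0" by force
    then show ?thesis using that cross2_eq_0_iff[of z "a + t *\<^sub>R e"] span_sing_eq_iff by blast
  qed
  \<comment> \<open>On the line \<open>a + t e\<close> both coordinates are affine functions of \<open>t\<close>. If \<open>P\<close> is the one that is
      negative at \<open>a - e\<close>, it increases, so \<open>R\<close> must be the one that is negative at \<open>b + e\<close>; the
      zeros of \<open>P\<close> and \<open>R\<close> are the two crossing points.\<close>
  have key: "\<exists>x y. -1 < x \<and> x \<le> 0 \<and> real k \<le> y \<and> y < real k + 1 \<and> P (a + x *\<^sub>R e) = 0 \<and> R (a + y *\<^sub>R e) = 0"
    if lin: "\<And>t. P (a + t *\<^sub>R e) = P a + t * P e" "\<And>t. R (a + t *\<^sub>R e) = R a + t * R e"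
      and nn: "0 \<le> P a" "0 \<le> P b" "0 \<le> R a" "0 \<le> R b"
      and neg: "P (a - e) < 0" "P (b + e) < 0 \<or> R (b + e) < 0"
    for P R :: "real^2 \<Rightarrow> real"
  proof -
    have "P (a - e) = P a - P e" using lin(1)[of "-1"] by simp
    then have Pe: "P a < P e" "P e > 0" using neg nn by auto
    have be: "b + e = a + (real k + 1) *\<^sub>R e" by (simp add: algebra_simps)
    have "P (b + e) = P a + (real k + 1) * P e" unfolding be by (rule lin(1))
    moreover have "(real k + 1) * P e > 0" using Pe by simp
    ultimately have "R (b + e) < 0" using neg nn by linarith
    then have Rbe: "R a + (real k + 1) * R e < 0" unfolding be lin(2) .
    moreover have Rb: "0 \<le> R a + real k * R e" using nn(4) lin(2) by simp
    ultimately have Re: "R e < 0" by (simp add: algebra_simps)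
    show ?thesis
    proof (intro exI conjI)
      show "-1 < - P a / P e" "- P a / P e \<le> 0" using Pe nn by (simp_all add: field_simps)
      show "real k \<le> - R a / R e" "- R a / R e < real k + 1"
        using Re Rbe Rb by (simp_all add: field_simps)
      show "P (a + (- P a / P e) *\<^sub>R e) = 0" "R (a + (- R a / R e) *\<^sub>R e) = 0"
        using lin[of "- P a / P e"] lin[of "- R a / R e"] Pe Re by simp_all
    qed
  qed
  have nn: "0 \<le> p a" "0 \<le> p b" "0 \<le> q a" "0 \<le> q b" using ab cw by (auto simp: S_def)
  have neg: "p (a - e) < 0 \<or> q (a - e) < 0" "p (b + e) < 0 \<or> q (b + e) < 0"
    using ends cw by (meson not_le)+
  from neg(1) show ?thesis
  proof
    assume "p (a - e) < 0"
    then obtain x y where "-1 < x" "x \<le> 0" "real k \<le> y" "y < real k + 1" "p (a + x *\<^sub>R e) = 0" "q (a + y *\<^sub>R e) = 0"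
      using key[of p q] lin nn neg by blast
    moreover from this have "span {a + x *\<^sub>R e} = span {w}" "span {a + y *\<^sub>R e} = span {v}"
      using on_w on_v same vw_nz by blast+
    ultimately show ?thesis by (intro exI[of _ x] exI[of _ y]) auto
  next
    assume "q (a - e) < 0"
    then obtain x y where "-1 < x" "x \<le> 0" "real k \<le> y" "y < real k + 1" "q (a + x *\<^sub>R e) = 0" "p (a + y *\<^sub>R e) = 0"
      using key[of q p] lin nn neg by blast
    moreover from this have "span {a + x *\<^sub>R e} = span {v}" "span {a + y *\<^sub>R e} = span {w}"
      using on_w on_v same vw_nz by blast+
    ultimately show ?thesis by (intro exI[of _ x] exI[of _ y]) auto
  qed
qed

lemma CF1_with_segment:
  "CF1_with_face (closed_segment a b) =
     {{span {a + x *\<^sub>R e}, span {a + y *\<^sub>R e}} | x y. -1 < x \<and> x \<le> 0 \<and> real k \<le> y \<and> y < real k + 1}"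
proof (intro equalityI subsetI)
  fix c assume c: "c \<in> CF1_with_face (closed_segment a b)"
  then have "c \<in> CF1" "is_face_of_cf (closed_segment a b) c" by (auto simp: CF1_with_face_def)
  then obtain lm where lm: "lm \<in> FCF1" "c = forget_order lm" by (auto simp: CF1_def)
  then obtain v w where vw: "lm = (span {v}, span {w})" "cross2 v w \<noteq> 0" by (auto elim: FCF1_cases)
  then have c_eq: "c = {span {v}, span {w}}" using lm by (simp add: forget_order_def)
  obtain C where C: "C \<in> open_cones c" "closed_segment a b edge_of cone_hull C"
    using \<open>is_face_of_cf _ c\<close> by (auto simp: is_face_of_cf_def)
  then obtain v' w' where vw': "span {v'} = span {v}" "span {w'} = span {w}" "cross2 v' w' \<noteq> 0" "C = wedge v' w'"
    using open_cones_cases[OF vw(2)] c_eq by metis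
  obtain x y where "-1 < x" "x \<le> 0" "real k \<le> y" "y < real k + 1"
     "{span {v'}, span {w'}} = {span {a + x *\<^sub>R e}, span {a + y *\<^sub>R e}}"
    using edge_of_hull_lines[OF vw'(3)] C vw' by blast
  then show "c \<in> {{span {a + x *\<^sub>R e}, span {a + y *\<^sub>R e}} | x y. -1 < x \<and> x \<le> 0 \<and> real k \<le> y \<and> y < real k + 1}"
    using c_eq vw' by auto
next
  fix c assume "c \<in> {{span {a + x *\<^sub>R e}, span {a + y *\<^sub>R e}} | x y. -1 < x \<and> x \<le> 0 \<and> real k \<le> y \<and> y < real k + 1}"
  then obtain x y where xy: "-1 < x" "x \<le> 0" "real k \<le> y" "y < real k + 1"
    and c: "c = {span {a + x *\<^sub>R e}, span {a + y *\<^sub>R e}}" by blast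
  note nz = cross_vw_nz[OF xy]
  have "(span {a + x *\<^sub>R e}, span {a + y *\<^sub>R e}) \<in> FCF1" using nz by (simp only: span_pair_in_FCF1_iff not_False_eq_True)
  then have "c \<in> CF1" unfolding CF1_def c by (rule rev_image_eqI) (simp add: forget_order_def)
  moreover have "is_face_of_cf (closed_segment a b) c"
    unfolding is_face_of_cf_def c sail_def
    using wedge_in_open_cones[OF nz] segment_edge_of_hull[OF xy] by blast
  ultimately show "c \<in> CF1_with_face (closed_segment a b)" by (simp add: CF1_with_face_def)
qed

end

section \<open>Segments at unit integer distance\<close>

lemma norm_cross2:
  fixes d e :: "real^2"
  shows "(cross2 d e)^2 + (d \<bullet> e)^2 = (norm d)^2 * (norm e)^2"
  unfolding power2_norm_eq_inner
  by (simp add: cross2_def inner_vec_def sum_2 power2_eq_square algebra_simps)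

text \<open>
  The lower bound is the Cauchy--Schwarz part of Lagrange's identity; it is attained at the foot \<open>p\<close> of
  the perpendicular.
\<close>

lemma infdist_line:
  fixes a e z :: "real^2"
  assumes "e \<noteq> 0"
  shows "infdist z (range (\<lambda>t. a + t *\<^sub>R e)) = \<bar>cross2 (z - a) e\<bar> / norm e"
proof -
  let ?l = "range (\<lambda>t. a + t *\<^sub>R e)"
  have ne: "norm e > 0" using assms by simp
  have "\<bar>cross2 (z - a) e\<bar> / norm e \<le> dist z p" if p_in: "p \<in> ?l" for p
  proof -
    obtain t where p: "p = a + t *\<^sub>R e" using p_in by auto
    have "cross2 (z - a) e = cross2 (z - p) e" by (simp add: p)
    moreover have "(cross2 (z - p) e)^2 \<le> (norm (z - p) * norm e)^2"
      using norm_cross2[of "z - p" e] by (simp add: power_mult_distrib)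
         (metis le_add_same_cancel1 zero_le_power2)
    then have "\<bar>cross2 (z - p) e\<bar> \<le> norm (z - p) * norm e"
      by (metis abs_le_square_iff abs_norm_cancel abs_mult)
    ultimately show ?thesis using ne by (simp add: dist_norm divide_le_eq)
  qed
  then have "\<bar>cross2 (z - a) e\<bar> / norm e \<le> infdist z ?l"
    unfolding infdist_def by (auto intro!: cINF_greatest)
  moreover have "\<exists>p\<in>?l. dist z p = \<bar>cross2 (z - a) e\<bar> / norm e"
  proof -
    define d where "d = z - a"
    define p where "p = a + (d \<bullet> e / (norm e)^2) *\<^sub>R e"
    have "(dist z p)^2 = (norm d)^2 - (d \<bullet> e)^2 / (norm e)^2"
    proof -
      have quadratic: "(norm (d - c *\<^sub>R e))^2 = (norm d)^2 - 2 * (c * (d \<bullet> e)) + c^2 * (norm e)^2" for c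
        unfolding power2_norm_eq_inner
        by (simp add: inner_diff_left inner_diff_right inner_commute power2_eq_square algebra_simps)
      have "z - p = d - (d \<bullet> e / (norm e)^2) *\<^sub>R e" by (simp add: p_def d_def)
      then have "(dist z p)^2 = (norm d)^2 - 2 * ((d \<bullet> e / (norm e)^2) * (d \<bullet> e)) + (d \<bullet> e / (norm e)^2)^2 * (norm e)^2"
        by (simp only: dist_norm quadratic)
      also have "\<dots> = (norm d)^2 - (d \<bullet> e)^2 / (norm e)^2"
        using ne by (simp add: power2_eq_square field_simps)
      finally show ?thesis .
    qed
    also have "\<dots> = (cross2 d e)^2 / (norm e)^2"
    proof -
      have "(norm d)^2 = ((cross2 d e)^2 + (d \<bullet> e)^2) / (norm e)^2"
        using norm_cross2[of d e] ne by (simp add: nonzero_eq_divide_eq)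
      then show ?thesis by (simp add: add_divide_distrib)
    qed
    also have "\<dots> = (\<bar>cross2 d e\<bar> / norm e)^2" by (simp add: power_divide)
    finally have "dist z p = \<bar>cross2 d e\<bar> / norm e"
      using ne by (simp add: power2_eq_iff_nonneg del: dist_norm)
    then show ?thesis unfolding p_def d_def by blast
  qed
  then have "infdist z ?l \<le> \<bar>cross2 (z - a) e\<bar> / norm e"
    using infdist_le by (metis (no_types, lifting))
  ultimately show ?thesis by (rule antisym[rotated])
qed

text \<open>
  Write \<open>b - a = g e\<close> with \<open>g\<close> the gcd of the two integer components. The interior integer points are
  \<open>a + j e\<close> with \<open>0 < j < g\<close>, so \<open>g\<close> is the integer length. By Bezout some integer point \<open>z\<close> has
  \<open>cross2 (z - a) e = 1\<close>, and distances to the line are proportional to the absolute value of this form;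
  unit integer distance therefore bounds the nonzero integer \<open>cross2 a e\<close> by one.
\<close>

lemma segment_integer_basis:
  fixes a b :: "real^2"
  assumes k: "k > 0" and ab: "a \<in> int_points" "b \<in> int_points" "a \<noteq> b"
    and len: "int_length a b = k" and unit: "unit_int_distance (affine hull {a, b})"
  shows "\<exists>e. b = a + real k *\<^sub>R e \<and> integer_basis a e k"
proof -
  obtain d1 d2 :: int where d: "b $ 1 - a $ 1 = of_int d1" "b $ 2 - a $ 2 = of_int d2"
    using ab by (metis Ints_cases Ints_diff int_points_iff)
  have dnz: "d1 \<noteq> 0 \<or> d2 \<noteq> 0" using ab(3) d by (auto simp: vec_eq_iff forall_2)
  define g where "g = gcd d1 d2"
  have g: "g > 0" using dnz by (simp add: g_def)
  obtain e1 e2 where e12: "d1 = g * e1" "d2 = g * e2"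
    unfolding g_def by (metis dvd_def gcd_dvd1 gcd_dvd2)
  obtain U V where "U * d1 + V * d2 = g" unfolding g_def using bezout_int by blast
  then have "g * (U * e1 + V * e2) = g * 1" unfolding e12 by (simp add: algebra_simps)
  then have UV: "U * e1 + V * e2 = 1" using g by simp
  then have UVr: "real_of_int U * of_int e1 + of_int V * of_int e2 = 1"
    by (metis of_int_1 of_int_add of_int_mult)
  define e :: "real^2" where "e = vector [of_int e1, of_int e2]"
  have e_comp [simp]: "e $ 1 = of_int e1" "e $ 2 = of_int e2" by (simp_all add: e_def)
  have e_int: "e \<in> int_points" by (simp add: int_points_iff)
  have enz: "e \<noteq> 0" using UV by (auto simp: vec_eq_iff forall_2)
  have b_eq: "b = a + of_int g *\<^sub>R e"
    using d e12 by (simp add: vec_eq_iff forall_2 algebra_simps)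
  have seg: "int_points \<inter> open_segment a b = (\<lambda>j. a + of_int j *\<^sub>R e) ` {0<..<g}"
  proof (intro equalityI subsetI)
    fix z assume z: "z \<in> int_points \<inter> open_segment a b"
    then obtain t where t: "0 < t" "t < 1" "z = (1 - t) *\<^sub>R a + t *\<^sub>R b" by (auto simp: in_segment)
    have zt: "z = a + (t * of_int g) *\<^sub>R e" unfolding t(3) b_eq by (simp add: algebra_simps)
    have "z - a \<in> int_points" using z ab by (auto intro: int_points_closed)
    then have "(t * of_int g) * of_int e1 \<in> \<int>" "(t * of_int g) * of_int e2 \<in> \<int>"
      using zt by (auto simp: int_points_iff)
    then have "of_int U * ((t * of_int g) * of_int e1) + of_int V * ((t * of_int g) * of_int e2) \<in> \<int>"
      by (intro Ints_add Ints_mult[OF Ints_of_int])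
    also have "of_int U * ((t * of_int g) * of_int e1) + of_int V * ((t * of_int g) * of_int e2)
      = (t * of_int g) * (of_int U * of_int e1 + of_int V * of_int e2)" by (simp add: algebra_simps)
    finally have "t * of_int g \<in> \<int>" unfolding UVr by simp
    then obtain j where j: "t * of_int g = of_int j" by (auto elim: Ints_cases)
    have "0 < t * of_int g" "t * of_int g < of_int g" using t g by simp_all
    then have "j \<in> {0<..<g}" unfolding j by simp
    then show "z \<in> (\<lambda>j. a + of_int j *\<^sub>R e) ` {0<..<g}" using zt j by auto
  next
    fix z assume "z \<in> (\<lambda>j. a + of_int j *\<^sub>R e) ` {0<..<g}"
    then obtain j where j: "0 < j" "j < g" "z = a + of_int j *\<^sub>R e" by auto
    have "z = (1 - of_int j / of_int g) *\<^sub>R a + (of_int j / of_int g) *\<^sub>R b"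
      unfolding b_eq j(3) using g by (simp add: algebra_simps)
    moreover have "0 < real_of_int j / of_int g" "real_of_int j / of_int g < 1" using j by auto
    ultimately have "z \<in> open_segment a b" unfolding in_segment using ab(3) by blast
    moreover have "z \<in> int_points" unfolding j(3) using ab e_int by (intro int_points_closed) auto
    ultimately show "z \<in> int_points \<inter> open_segment a b" by blast
  qed
  have "inj_on (\<lambda>j. a + of_int j *\<^sub>R e) {0<..<g}" using enz by (auto intro!: inj_onI)
  then have "card (int_points \<inter> open_segment a b) = nat (g - 1)"
    unfolding seg by (simp add: card_image)
  then have kg: "int k = g" using len g by (simp add: int_length_def)
  then have b: "b = a + real k *\<^sub>R e" using b_eq by (metis of_int_of_nat_eq)
  have line: "affine hull {a, b} = range (\<lambda>t. a + t *\<^sub>R e)"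
  proof (intro equalityI subsetI)
    fix z assume "z \<in> affine hull {a, b}"
    then obtain u v where uv: "z = u *\<^sub>R a + v *\<^sub>R b" "u + v = 1" by (auto simp: affine_hull_2)
    then have "u = 1 - v" by simp
    then have "z = a + (v * real k) *\<^sub>R e" unfolding uv(1) b \<open>u = 1 - v\<close> by (simp add: algebra_simps)
    then show "z \<in> range (\<lambda>t. a + t *\<^sub>R e)" by blast
  next
    fix z assume "z \<in> range (\<lambda>t. a + t *\<^sub>R e)"
    then obtain t where t: "z = a + t *\<^sub>R e" by blast
    have "z = (1 - t / real k) *\<^sub>R a + (t / real k) *\<^sub>R b"
      unfolding t b using k by (simp add: algebra_simps)
    then show "z \<in> affine hull {a, b}" unfolding affine_hull_2 by force
  qed
  have "0 \<notin> range (\<lambda>t. a + t *\<^sub>R e)" using unit unfolding unit_int_distance_def line by blast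
  then have nz: "cross2 a e \<noteq> 0"
  proof (rule contrapos_nn)
    assume "cross2 a e = 0"
    then obtain c where "a = c *\<^sub>R e" using cross2_eq_0_iff[OF enz] by (auto simp: span_singleton)
    then have "0 = a + (- c) *\<^sub>R e" by simp
    then show "0 \<in> range (\<lambda>t. a + t *\<^sub>R e)" by blast
  qed
  \<comment> \<open>An integer point on a neighbouring line, from the Bezout coefficients.\<close>
  define z :: "real^2" where "z = a + vector [of_int V, - of_int U]"
  have z_int: "z \<in> int_points" using ab by (auto simp: z_def int_points_iff)
  have cz: "cross2 (z - a) e = 1" using UVr by (simp add: z_def cross2_def algebra_simps)
  have en: "norm e > 0" using enz by simp
  have "infdist z (affine hull {a, b}) \<noteq> 0" unfolding line infdist_line[OF enz] cz using en by simp
  then have "infdist 0 (affine hull {a, b}) \<le> infdist z (affine hull {a, b})"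
    using unit z_int unfolding unit_int_distance_def by blast
  then have "\<bar>cross2 (0 - a) e\<bar> / norm e \<le> 1 / norm e"
    unfolding line infdist_line[OF enz] cz by simp
  then have "\<bar>cross2 (0 - a) e\<bar> \<le> 1" using en by (simp add: divide_le_cancel)
  moreover have "cross2 (0 - a) e = - cross2 a e" by (simp add: cross2_def)
  ultimately have le: "\<bar>cross2 a e\<bar> \<le> 1" by linarith
  obtain j where "cross2 a e = of_int j" using cross2_int[OF ab(1) e_int] by (auto elim: Ints_cases)
  then have "\<bar>cross2 a e\<bar> = 1" using le nz by auto
  then have "integer_basis a e k" using ab e_int k by unfold_locales
  then show ?thesis using b by blast
qed

section \<open>The relative frequency of a segment\<close>

lemma nn_integral_interval_ends:
  fixes f :: "real \<Rightarrow> ennreal"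
  assumes "{a<..<b} \<subseteq> I" "I \<subseteq> {a..b}"
  shows "(\<integral>\<^sup>+x\<in>I. f x \<partial>lborel) = (\<integral>\<^sup>+x\<in>{a..b}. f x \<partial>lborel)"
proof (rule nn_integral_cong_AE)
  have "AE x in lborel. x \<notin> {a, b}"
    by (intro AE_not_in countable_imp_null_set_lborel) simp
  then show "AE x in lborel. f x * indicator I x = f x * indicator {a..b} x"
  proof eventually_elim
    fix x assume "x \<notin> {a, b}"
    then have "x \<in> I \<longleftrightarrow> x \<in> {a..b}" using assms by force
    then show "f x * indicator I x = f x * indicator {a..b} x" by (simp add: indicator_def)
  qed
qed

text \<open>
  The measure of a rectangle off the diagonal is the logarithm of the cross-ratio of its four
  boundary coordinates.
\<close>

lemma nn_integral_rectangle:
  fixes a b c d :: real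
  assumes "a \<le> b" "b < c" "c \<le> d"
  shows "(\<integral>\<^sup>+x\<in>{a..b}. (\<integral>\<^sup>+y\<in>{c..d}. ennreal (1 / (x - y)^2) \<partial>lborel) \<partial>lborel)
     = ennreal (ln (((d - b) * (c - a)) / ((c - b) * (d - a))))"
proof -
  have inner: "(\<integral>\<^sup>+y\<in>{c..d}. ennreal (1 / (x - y)^2) \<partial>lborel) = ennreal (1 / (x - d) - 1 / (x - c))"
    if x: "x \<in> {a..b}" for x
  proof (rule nn_integral_FTC_Icc[where F = "\<lambda>y. 1 / (x - y)"])
    fix y assume "y \<in> {c..d}"
    then have "x - y \<noteq> 0" using x assms by auto
    then show "((\<lambda>y. 1 / (x - y)) has_real_derivative 1 / (x - y)^2) (at y)"
      by (auto intro!: derivative_eq_intros simp: power2_eq_square)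
  qed (use assms in auto)
  have "(\<integral>\<^sup>+x\<in>{a..b}. (\<integral>\<^sup>+y\<in>{c..d}. ennreal (1 / (x - y)^2) \<partial>lborel) \<partial>lborel)
     = (\<integral>\<^sup>+x\<in>{a..b}. ennreal (1 / (x - d) - 1 / (x - c)) \<partial>lborel)"
    by (rule nn_integral_cong) (auto simp: inner split: split_indicator)
  also have "\<dots> = ennreal ((ln (d - b) - ln (c - b)) - (ln (d - a) - ln (c - a)))"
  proof (rule nn_integral_FTC_Icc[where F = "\<lambda>x. ln (d - x) - ln (c - x)"])
    fix x assume "x \<in> {a..b}"
    then have pos: "c - x > 0" "d - x > 0" using assms by auto
    then show "((\<lambda>x. ln (d - x) - ln (c - x)) has_real_derivative 1 / (x - d) - 1 / (x - c)) (at x)"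
      by (auto intro!: derivative_eq_intros simp: field_simps)
    have "1 / (d - x) \<le> 1 / (c - x)" using pos assms by (intro divide_left_mono) auto
    moreover have "1 / (x - d) = - (1 / (d - x))" "1 / (x - c) = - (1 / (c - x))"
      by (simp_all add: minus_divide_right)
    ultimately show "0 \<le> 1 / (x - d) - 1 / (x - c)" by linarith
  qed (use assms in auto)
  also have "(ln (d - b) - ln (c - b)) - (ln (d - a) - ln (c - a)) = ln (((d - b) * (c - a)) / ((c - b) * (d - a)))"
    using assms by (simp add: ln_div ln_mult)
  finally show ?thesis .
qed

text \<open>
  The density is symmetric, so a rectangle and its mirror image have the same measure; both are stated
  with the same order of integration.
\<close>

lemma mu_omega1_rectangle:
  assumes u: "norm u = 1" and au: "cross2 a u \<noteq> 0"
    and A: "A \<in> sets borel" and B: "B \<in> sets borel" and disj: "A \<inter> B = {}"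
  shows "emeasure mu_omega1 {p \<in> FCF1_chart a u. chart_coords a u p \<in> A \<times> B}
        = (\<integral>\<^sup>+x\<in>A. (\<integral>\<^sup>+y\<in>B. ennreal (1 / (x - y)^2) \<partial>lborel) \<partial>lborel)" (is ?th1)
    and "emeasure mu_omega1 {p \<in> FCF1_chart a u. chart_coords a u p \<in> B \<times> A}
        = (\<integral>\<^sup>+x\<in>A. (\<integral>\<^sup>+y\<in>B. ennreal (1 / (x - y)^2) \<partial>lborel) \<partial>lborel)" (is ?th2)
proof -
  have gen: "emeasure mu_omega1 {p \<in> FCF1_chart a u. chart_coords a u p \<in> X \<times> Y}
      = (\<integral>\<^sup>+z. ennreal (1 / (fst z - snd z)^2) * indicator (X \<times> Y) z \<partial>(lborel \<Otimes>\<^sub>M lborel))"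
    if X: "X \<in> sets borel" and Y: "Y \<in> sets borel" and XY: "X \<inter> Y = {}" for X Y
  proof -
    have "{z. line_pair a u z \<in> {p \<in> FCF1_chart a u. chart_coords a u p \<in> X \<times> Y}} = X \<times> Y"
    proof -
      have "line_pair a u z \<in> FCF1_chart a u" if "z \<in> X \<times> Y" for z
      proof (cases z)
        case (Pair s t)
        then have "s \<noteq> t" using that XY by auto
        then show ?thesis unfolding Pair by (rule line_pair_in_chart[OF au])
      qed
      then show ?thesis by (simp only: mem_Collect_eq chart_coords_line_pair[OF au]) blast
    qed
    moreover have "X \<times> Y \<in> sets borel" using X Y by (simp add: borel_Times)
    then have "{p \<in> FCF1_chart a u. chart_coords a u p \<in> X \<times> Y} \<in> sets FCF1_borel"
      by (rule chart_coords_measurable[OF au])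
    ultimately show ?thesis
      by (subst emeasure_mu_omega1[OF u au]) (auto simp: chart_integral_def lborel_prod)
  qed
  have meas: "(\<lambda>z. ennreal (1 / (fst z - snd z)^2) * indicator (X \<times> Y) z) \<in> borel_measurable (lborel \<Otimes>\<^sub>M lborel)"
    if X: "X \<in> sets borel" and Y: "Y \<in> sets borel" for X Y :: "real set"
  proof -
    have "X \<times> Y \<in> sets borel" using X Y by (simp add: borel_Times)
    then have "(\<lambda>z. ennreal (1 / (fst z - snd z)^2) * indicator (X \<times> Y) z) \<in> borel_measurable borel"
      by (intro borel_measurable_times_ennreal borel_measurable_kernel borel_measurable_indicator)
    then show ?thesis by (simp add: lborel_prod)
  qed
  show ?th1
    unfolding gen[OF A B disj] lborel.nn_integral_fst[OF meas[OF A B], symmetric]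
    by (rule nn_integral_cong) (auto simp: indicator_def intro!: nn_integral_cong)
  have "B \<inter> A = {}" using disj by blast
  show ?th2
    unfolding gen[OF B A \<open>B \<inter> A = {}\<close>] lborel_pair.nn_integral_snd[OF meas[OF B A], symmetric]
    by (rule nn_integral_cong) (auto simp: indicator_def power2_commute intro!: nn_integral_cong)
qed

text \<open>
  The chart on the line of the segment has the Euclidean coordinate, in which \<open>e\<close> has length
  \<open>E\<close>; the cross-ratio does not depend on \<open>E\<close>.
\<close>

lemma (in integer_basis) mu1_segment:
  "mu1 (CF1_with_face (closed_segment a b)) = ennreal (ln ((real k + 1)^2 / (real k * (real k + 2))))"
proof -
  define E where "E = norm e"
  define u where "u = e /\<^sub>R E"
  have E: "E > 0" using e_nz by (simp add: E_def)
  have u: "norm u = 1" using E by (simp add: u_def E_def)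
  have au: "cross2 a u \<noteq> 0" using cross_nz E by (simp add: u_def)
  have scale: "a + s *\<^sub>R e = a + (s * E) *\<^sub>R u" for s using E by (simp add: u_def)
  define A where "A = {- E<..0}"
  define B where "B = {real k * E..<(real k + 1) * E}"
  define S where "S = (\<lambda>R. {p \<in> FCF1_chart a u. chart_coords a u p \<in> R})"
  have k1: "real k \<ge> 1" using k_pos by simp
  have kE: "0 < real k * E" using k_pos E by simp
  have disj: "A \<inter> B = {}" using kE by (auto simp: A_def B_def)
  have A_iff: "s * E \<in> A \<longleftrightarrow> -1 < s \<and> s \<le> 0" for s
  proof -
    have "- E < s * E \<longleftrightarrow> (-1) * E < s * E" by simp
    also have "\<dots> \<longleftrightarrow> -1 < s" using E by (simp only: mult_less_cancel_right_pos)
    finally show ?thesis using E by (auto simp: A_def mult_le_0_iff)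
  qed
  have B_iff: "s * E \<in> B \<longleftrightarrow> real k \<le> s \<and> s < real k + 1" for s
    using E by (simp add: B_def)
  have S_iff: "p \<in> S R \<longleftrightarrow> (\<exists>s t. s \<noteq> t \<and> (s * E, t * E) \<in> R \<and> p = (span {a + s *\<^sub>R e}, span {a + t *\<^sub>R e}))" for p R
  proof
    assume p: "p \<in> S R"
    obtain s t where st: "chart_coords a u p = (s, t)" by fastforce
    have lp: "p = line_pair a u (s, t)" using line_pair_chart_coords[OF au, of p] p st by (simp add: S_def)
    moreover have "p \<in> FCF1" using p by (auto simp: S_def FCF1_chart_def)
    ultimately have "s \<noteq> t" using line_pair_in_FCF1[OF au] by simp
    then have "s / E \<noteq> t / E" "(s / E * E, t / E * E) \<in> R"
      "p = (span {a + (s / E) *\<^sub>R e}, span {a + (t / E) *\<^sub>R e})"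
      using p st lp E by (auto simp: S_def scale line_pair_def)
    then show "\<exists>s t. s \<noteq> t \<and> (s * E, t * E) \<in> R \<and> p = (span {a + s *\<^sub>R e}, span {a + t *\<^sub>R e})" by blast
  next
    assume "\<exists>s t. s \<noteq> t \<and> (s * E, t * E) \<in> R \<and> p = (span {a + s *\<^sub>R e}, span {a + t *\<^sub>R e})"
    then obtain s t where st: "s \<noteq> t" "(s * E, t * E) \<in> R" "p = line_pair a u (s * E, t * E)"
      by (auto simp: scale line_pair_def)
    have "s * E \<noteq> t * E" using st E by simp
    then show "p \<in> S R"
      unfolding S_def st(3) using line_pair_in_chart[OF au] chart_coords_line_pair[OF au] st(2) by simp
  qed
  have "forget_order -` CF1_with_face (closed_segment a b) \<inter> FCF1 = S (A \<times> B) \<union> S (B \<times> A)"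
  proof (intro equalityI subsetI)
    fix p assume p: "p \<in> forget_order -` CF1_with_face (closed_segment a b) \<inter> FCF1"
    obtain l m where lm: "p = (l, m)" by fastforce
    obtain x y where xy: "-1 < x" "x \<le> 0" "real k \<le> y" "y < real k + 1"
      "{l, m} = {span {a + x *\<^sub>R e}, span {a + y *\<^sub>R e}}"
      using p unfolding CF1_with_segment lm by (auto simp: forget_order_def)
    then have mem: "(x * E, y * E) \<in> A \<times> B" "(y * E, x * E) \<in> B \<times> A" "x \<noteq> y"
      using A_iff B_iff k1 by auto
    have "p = (span {a + x *\<^sub>R e}, span {a + y *\<^sub>R e}) \<or> p = (span {a + y *\<^sub>R e}, span {a + x *\<^sub>R e})"
      using xy(5) lm by (auto simp: doubleton_eq_iff)
    then show "p \<in> S (A \<times> B) \<union> S (B \<times> A)" using mem unfolding Un_iff S_iff by metis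
  next
    fix p assume p: "p \<in> S (A \<times> B) \<union> S (B \<times> A)"
    then have "p \<in> FCF1" by (auto simp: S_def FCF1_chart_def)
    moreover have "forget_order p \<in> CF1_with_face (closed_segment a b)"
    proof -
      from p obtain x y where "(x * E, y * E) \<in> A \<times> B"
        "p = (span {a + x *\<^sub>R e}, span {a + y *\<^sub>R e}) \<or> p = (span {a + y *\<^sub>R e}, span {a + x *\<^sub>R e})"
        unfolding Un_iff S_iff by blast
      then have "-1 < x \<and> x \<le> 0 \<and> real k \<le> y \<and> y < real k + 1"
        "forget_order p = {span {a + x *\<^sub>R e}, span {a + y *\<^sub>R e}}"
        using A_iff B_iff by (auto simp: forget_order_def)
      then show ?thesis unfolding CF1_with_segment by blast
    qed
    ultimately show "p \<in> forget_order -` CF1_with_face (closed_segment a b) \<inter> FCF1" by simp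
  qed
  then have "mu1 (CF1_with_face (closed_segment a b)) = emeasure mu_omega1 (S (A \<times> B) \<union> S (B \<times> A)) / 2"
    by (simp add: mu1_def)
  also have "emeasure mu_omega1 (S (A \<times> B) \<union> S (B \<times> A)) = emeasure mu_omega1 (S (A \<times> B)) + emeasure mu_omega1 (S (B \<times> A))"
  proof (rule plus_emeasure[symmetric])
    have "A \<times> B \<in> sets borel" "B \<times> A \<in> sets borel" by (auto simp: A_def B_def intro!: borel_Times)
    then show "S (A \<times> B) \<in> sets mu_omega1" "S (B \<times> A) \<in> sets mu_omega1"
      unfolding sets_mu_omega1 S_def by (auto intro!: chart_coords_measurable[OF au])
    show "S (A \<times> B) \<inter> S (B \<times> A) = {}" using disj by (auto simp: S_def)
  qed
  also have "\<dots> = ennreal (ln ((real k + 1)^2 / (real k * (real k + 2)))) + ennreal (ln ((real k + 1)^2 / (real k * (real k + 2))))"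
  proof -
    define c d where "c = real k * E" and "d = (real k + 1) * E"
    have "(\<integral>\<^sup>+x\<in>A. (\<integral>\<^sup>+y\<in>B. ennreal (1 / (x - y)^2) \<partial>lborel) \<partial>lborel)
      = (\<integral>\<^sup>+x\<in>A. (\<integral>\<^sup>+y\<in>{c..d}. ennreal (1 / (x - y)^2) \<partial>lborel) \<partial>lborel)"
      by (subst nn_integral_interval_ends[of c d B]) (auto simp: B_def c_def d_def)
    also have "\<dots> = (\<integral>\<^sup>+x\<in>{- E..0}. (\<integral>\<^sup>+y\<in>{c..d}. ennreal (1 / (x - y)^2) \<partial>lborel) \<partial>lborel)"
      by (rule nn_integral_interval_ends) (auto simp: A_def)
    also have "\<dots> = ennreal (ln (((d - 0) * (c - (- E))) / ((c - 0) * (d - (- E)))))"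
      by (rule nn_integral_rectangle) (use E kE in \<open>auto simp: c_def d_def\<close>)
    also have "((d - 0) * (c - (- E))) / ((c - 0) * (d - (- E))) = (real k + 1)^2 / (real k * (real k + 2))"
    proof -
      have "(d - 0) * (c - (- E)) = (real k + 1)^2 * E^2" "(c - 0) * (d - (- E)) = (real k * (real k + 2)) * E^2"
        by (simp_all add: c_def d_def power2_eq_square algebra_simps)
      then show ?thesis using E by simp
    qed
    finally have I: "(\<integral>\<^sup>+x\<in>A. (\<integral>\<^sup>+y\<in>B. ennreal (1 / (x - y)^2) \<partial>lborel) \<partial>lborel)
      = ennreal (ln ((real k + 1)^2 / (real k * (real k + 2))))" .
    have "A \<in> sets borel" "B \<in> sets borel" by (simp_all add: A_def B_def)
    from mu_omega1_rectangle[OF u au this disj] show ?thesis unfolding S_def I by simp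
  qed
  also have "(ennreal r + ennreal r) / 2 = ennreal r" for r
    by (metis ennreal_times_divide mult_2 mult.commute divide_mult_eq ennreal_zero_neq_top mult_divide_eq_ennreal top_neq_numeral zero_neq_numeral)
  finally show ?thesis .
qed

section \<open>Digits and the Gauss map\<close>

definition gauss_map :: "real \<Rightarrow> real" where
  "gauss_map x = frac (1 / x)"

definition cf_digit :: "real \<Rightarrow> nat \<Rightarrow> nat" where
  "cf_digit \<alpha> i = nat \<lfloor>1 / (gauss_map ^^ (i - 1)) \<alpha>\<rfloor>"

lemma gauss_map_irrational:
  assumes "x \<notin> \<rat>"
  shows "gauss_map x \<notin> \<rat>" "gauss_map x \<in> {0<..<1}"
proof -
  show 1: "gauss_map x \<notin> \<rat>"
  proof
    assume "gauss_map x \<in> \<rat>"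
    then have "frac (1 / x) + of_int \<lfloor>1 / x\<rfloor> \<in> \<rat>" by (simp add: gauss_map_def)
    then have "1 / x \<in> \<rat>" by (simp add: frac_def)
    from Rats_divide[OF Rats_1 this] show False using assms by simp
  qed
  then have "gauss_map x \<noteq> 0" by auto
  then show "gauss_map x \<in> {0<..<1}"
    using frac_ge_0[of "1 / x"] frac_lt_1[of "1 / x"] by (simp add: gauss_map_def)
qed

lemma gauss_map_expand:
  assumes "x \<in> {0<..<1}"
  shows "x = 1 / (real (nat \<lfloor>1 / x\<rfloor>) + gauss_map x)" "nat \<lfloor>1 / x\<rfloor> > 0"
proof -
  have "1 \<le> 1 / x" using assms by simp
  then have "\<lfloor>1 / x\<rfloor> \<ge> 1" by (simp add: le_floor_iff)
  then show "nat \<lfloor>1 / x\<rfloor> > 0" by simp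
  have "real (nat \<lfloor>1 / x\<rfloor>) = of_int \<lfloor>1 / x\<rfloor>" using \<open>\<lfloor>1 / x\<rfloor> \<ge> 1\<close> by (simp only: of_nat_nat)
  then show "x = 1 / (real (nat \<lfloor>1 / x\<rfloor>) + gauss_map x)"
    by (simp add: gauss_map_def frac_def del: of_nat_nat)
qed

lemma gauss_map_orbit:
  assumes "\<alpha> \<in> {0<..<1}" "\<alpha> \<notin> \<rat>"
  shows "(gauss_map ^^ j) \<alpha> \<in> {0<..<1} \<and> (gauss_map ^^ j) \<alpha> \<notin> \<rat>"
proof (induction j)
  case (Suc j)
  then show ?case using gauss_map_irrational[of "(gauss_map ^^ j) \<alpha>"] by simp
qed (use assms in simp)

lemma cf_digit_pos: "\<alpha> \<in> {0<..<1} \<Longrightarrow> \<alpha> \<notin> \<rat> \<Longrightarrow> cf_digit \<alpha> i > 0"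
  unfolding cf_digit_def using gauss_map_expand(2) gauss_map_orbit by blast

lemma map_upt_Suc_Suc: "map a [1..<Suc (Suc n)] = a 1 # map (a \<circ> Suc) [1..<Suc n]"
proof -
  have "[1..<Suc (Suc n)] = 1 # map Suc [1..<Suc n]"
    by (subst upt_conv_Cons) (simp_all add: map_Suc_upt del: upt_Suc)
  then show ?thesis by (simp del: upt_Suc)
qed

lemma cf_value_bounds:
  assumes "\<forall>a\<in>set as. a > 0"
  shows "0 \<le> cf_value as \<and> cf_value as \<le> 1"
  using assms
proof (induction as)
  case (Cons a as)
  then have "real a \<ge> 1" "0 \<le> cf_value as" by auto
  then show ?case by simp
qed simp

text \<open>
  The convergents satisfy \<open>c (n + 1) = 1 / (a 1 + s n)\<close>, where \<open>s n\<close> are the convergents of the shifted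
  sequence. Hence \<open>s\<close> converges to \<open>1 / \<alpha> - a 1\<close>, a number in the unit interval. It is irrational, so it
  is not an endpoint, and \<open>a 1\<close> is the integer part of \<open>1 / \<alpha>\<close>.
\<close>

lemma has_cf_step:
  assumes cf: "has_cf a \<alpha>" and irr: "\<alpha> \<notin> \<rat>"
  shows "nat \<lfloor>1 / \<alpha>\<rfloor> = a 1" "has_cf (a \<circ> Suc) (gauss_map \<alpha>)"
proof -
  define s where "s = (\<lambda>n. cf_value (map (a \<circ> Suc) [1..<Suc n]))"
  have pos: "a i > 0" if "i \<ge> 1" for i using cf that by (simp add: has_cf_def)
  have s: "0 \<le> s n" "s n \<le> 1" for n
    using cf_value_bounds[of "map (a \<circ> Suc) [1..<Suc n]"] pos by (auto simp: s_def)
  have "(\<lambda>n. cf_value (map a [1..<Suc n])) \<longlonglongrightarrow> \<alpha>" using cf by (simp add: has_cf_def)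
  then have "(\<lambda>n. cf_value (map a [1..<Suc (Suc n)])) \<longlonglongrightarrow> \<alpha>" by (rule LIMSEQ_Suc)
  then have lim: "(\<lambda>n. 1 / (real (a 1) + s n)) \<longlonglongrightarrow> \<alpha>"
    by (simp add: map_upt_Suc_Suc s_def del: upt_Suc One_nat_def)
  have "\<alpha> \<noteq> 0" using irr by auto
  have "(\<lambda>n. 1 / (1 / (real (a 1) + s n)) - real (a 1)) \<longlonglongrightarrow> 1 / \<alpha> - real (a 1)"
    by (intro tendsto_intros lim) fact
  then have s_lim: "s \<longlonglongrightarrow> 1 / \<alpha> - real (a 1)" by simp
  have le: "0 \<le> 1 / \<alpha> - real (a 1)" "1 / \<alpha> - real (a 1) \<le> 1"
    by (rule LIMSEQ_le_const[OF s_lim], use s in blast)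
       (rule LIMSEQ_le_const2[OF s_lim], use s in blast)
  have "1 / \<alpha> \<noteq> real (a 1) + 1"
  proof
    assume "1 / \<alpha> = real (a 1) + 1"
    then have "\<alpha> = 1 / (real (a 1) + 1)" by (simp add: field_simps \<open>\<alpha> \<noteq> 0\<close>)
    then show False using irr by simp
  qed
  then have fl: "\<lfloor>1 / \<alpha>\<rfloor> = int (a 1)" using le by (intro floor_unique) auto
  then show "nat \<lfloor>1 / \<alpha>\<rfloor> = a 1" by simp
  have "gauss_map \<alpha> = 1 / \<alpha> - real (a 1)" by (simp add: gauss_map_def frac_def fl)
  then show "has_cf (a \<circ> Suc) (gauss_map \<alpha>)"
    using s_lim pos by (simp add: has_cf_def s_def del: upt_Suc)
qed

lemma has_cf_digit:
  assumes "has_cf a \<alpha>" "\<alpha> \<notin> \<rat>"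
  shows "a (Suc n) = cf_digit \<alpha> (Suc n)"
  using assms
proof (induction n arbitrary: a \<alpha>)
  case 0
  then show ?case using has_cf_step(1) by (simp add: cf_digit_def)
next
  case (Suc n)
  have "(a \<circ> Suc) (Suc n) = cf_digit (gauss_map \<alpha>) (Suc n)"
    using Suc.IH[OF has_cf_step(2)[OF Suc.prems]] gauss_map_irrational(1)[OF Suc.prems(2)] by simp
  then show ?case by (simp add: cf_digit_def funpow_swap1)
qed

text \<open>
  A single step \<open>x \<mapsto> 1 / (a + x)\<close> is not a uniform contraction of the unit interval when \<open>a = 1\<close>, but it
  maps distance \<open>d\<close> to at most \<open>d / (1 + d)\<close>, since the denominators satisfy
  \<open>(a + x) (a + y) \<ge> 1 + \<bar>x - y\<bar>\<close>. Iterating \<open>d / (1 + d)\<close> from \<open>1\<close> gives \<open>1 / (n + 1)\<close>.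
\<close>

lemma cf_step_contraction:
  fixes a x y d :: real
  assumes "a \<ge> 1" "x \<ge> 0" "y \<ge> 0" "\<bar>x - y\<bar> \<le> d"
  shows "\<bar>1 / (a + x) - 1 / (a + y)\<bar> \<le> d / (1 + d)"
proof -
  have *: "1 / (a + x) - 1 / (a + y) \<le> d / (1 + d)" if "x \<ge> 0" "x \<le> y" "y - x \<le> d" for x y
  proof -
    have pos: "a + x \<ge> 1" "a + y \<ge> 1 + (y - x)" using that assms(1) by auto
    have "1 / (a + x) - 1 / (a + y) = (y - x) / ((a + x) * (a + y))"
      using pos that by (simp add: field_simps)
    also have "\<dots> \<le> (y - x) / (1 * (1 + (y - x)))"
      using pos that by (intro divide_left_mono mult_mono) auto
    also have "\<dots> = 1 - 1 / (1 + (y - x))" using that by (simp add: field_simps)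
    also have "\<dots> \<le> 1 - 1 / (1 + d)" using that by (simp add: frac_le)
    also have "\<dots> = d / (1 + d)" using that by (simp add: field_simps)
    finally show ?thesis .
  qed
  show ?thesis
  proof (cases "x \<le> y")
    case True
    then have "1 / (a + y) \<le> 1 / (a + x)" using assms by (intro divide_left_mono) auto
    then show ?thesis using *[of x y] assms True by simp
  next
    case False
    then have "1 / (a + x) \<le> 1 / (a + y)" using assms by (intro divide_left_mono) auto
    then show ?thesis using *[of y x] assms False by simp
  qed
qed

text \<open>
  This gives the convergence of the continued fraction: the error after \<open>n\<close> digits is an
  \<open>n\<close>-fold iterate of \<open>cf_step_contraction\<close>.
\<close>

lemma cf_digit_approx:
  assumes "\<alpha> \<in> {0<..<1}" "\<alpha> \<notin> \<rat>"
  shows "\<bar>\<alpha> - cf_value (map (cf_digit \<alpha>) [1..<Suc n])\<bar> \<le> 1 / (real n + 1)"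
  using assms
proof (induction n arbitrary: \<alpha>)
  case (Suc n)
  define \<beta> where "\<beta> = gauss_map \<alpha>"
  define c where "c = cf_value (map (cf_digit \<beta>) [1..<Suc n])"
  have \<beta>: "\<beta> \<in> {0<..<1}" "\<beta> \<notin> \<rat>" using gauss_map_irrational[OF Suc.prems(2)] by (auto simp: \<beta>_def)
  have digit_Suc: "cf_digit \<alpha> (Suc i) = cf_digit \<beta> i" if "i \<ge> 1" for i
    using that by (cases i) (simp_all add: cf_digit_def \<beta>_def funpow_swap1)
  have tail: "map (cf_digit \<alpha> \<circ> Suc) [1..<Suc n] = map (cf_digit \<beta>) [1..<Suc n]"
    using digit_Suc by (auto simp del: upt_Suc)
  have pos: "cf_digit \<beta> i > 0" for i using cf_digit_pos[OF \<beta>] .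
  have c: "0 \<le> c" using cf_value_bounds[of "map (cf_digit \<beta>) [1..<Suc n]"] pos by (auto simp: c_def)
  have d1: "cf_digit \<alpha> 1 = nat \<lfloor>1 / \<alpha>\<rfloor>" by (simp add: cf_digit_def)
  have d1_ge: "real (cf_digit \<alpha> 1) \<ge> 1"
    using gauss_map_expand(2)[OF Suc.prems(1)] unfolding d1 by linarith
  have "cf_value (map (cf_digit \<alpha>) [1..<Suc (Suc n)]) = 1 / (real (cf_digit \<alpha> 1) + c)"
    by (simp add: map_upt_Suc_Suc tail c_def del: upt_Suc One_nat_def)
  moreover have "\<alpha> = 1 / (real (cf_digit \<alpha> 1) + \<beta>)"
    unfolding d1 \<beta>_def by (rule gauss_map_expand(1)[OF Suc.prems(1)])
  moreover have "\<bar>1 / (real (cf_digit \<alpha> 1) + \<beta>) - 1 / (real (cf_digit \<alpha> 1) + c)\<bar>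
      \<le> (1 / (real n + 1)) / (1 + 1 / (real n + 1))"
    using Suc.IH[OF \<beta>] d1_ge c \<beta>
    by (intro cf_step_contraction) (simp_all add: c_def del: upt_Suc One_nat_def)
  moreover have "(1 / (real n + 1)) / (1 + 1 / (real n + 1)) = 1 / (real (Suc n) + 1)"
    by (simp add: field_simps)
  ultimately show ?case by metis
qed simp

lemma has_cf_cf_digit:
  assumes "\<alpha> \<in> {0<..<1}" "\<alpha> \<notin> \<rat>"
  shows "has_cf (cf_digit \<alpha>) \<alpha>"
proof -
  have pos: "cf_digit \<alpha> i > 0" for i using cf_digit_pos[OF assms] .
  have "(\<lambda>n. cf_value (map (cf_digit \<alpha>) [1..<Suc n]) - \<alpha>) \<longlonglongrightarrow> 0"
  proof (rule Lim_null_comparison)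
    show "\<forall>\<^sub>F n in sequentially. norm (cf_value (map (cf_digit \<alpha>) [1..<Suc n]) - \<alpha>) \<le> 1 / (real n + 1)"
      using cf_digit_approx[OF assms] by (simp add: abs_minus_commute del: upt_Suc)
    show "(\<lambda>n. 1 / (real n + 1)) \<longlonglongrightarrow> 0"
      using LIMSEQ_inverse_real_of_nat by (simp add: inverse_eq_divide add.commute)
  qed
  then have "(\<lambda>n. cf_value (map (cf_digit \<alpha>) [1..<Suc n])) \<longlonglongrightarrow> \<alpha>"
    by (rule LIM_zero_cancel)
  then show ?thesis using pos by (simp only: has_cf_def simp_thms)
qed

lemma cf_digit_set_eq:
  "{\<alpha> \<in> {0..1}. \<alpha> \<notin> \<rat> \<and> (\<exists>a. has_cf a \<alpha> \<and> a (Suc n) = k)}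
     = {\<alpha> \<in> {0<..<1}. cf_digit \<alpha> (Suc n) = k} - \<rat>"
proof -
  have "\<alpha> \<in> {0<..<1}" if "\<alpha> \<in> {0..1}" "\<alpha> \<notin> \<rat>" for \<alpha> :: real
    using that by (metis Rats_0 Rats_1 atLeastAtMost_iff greaterThanLessThan_iff less_eq_real_def)
  then show ?thesis using has_cf_digit has_cf_cf_digit by fastforce
qed

section \<open>The transfer operator of the Gauss map\<close>

lemma gauss_map_measurable [measurable]: "gauss_map \<in> borel_measurable borel"
  unfolding gauss_map_def frac_def by measurable

text \<open>
  Substitution along the inverse branches \<open>y \<mapsto> 1 / (k + 1 + y)\<close>, which map the unit interval onto the
  intervals \<open>I k\<close> of constant digit \<open>k + 1\<close>.
\<close>

lemma nn_integral_gauss_map: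
  fixes f h :: "real \<Rightarrow> ennreal"
  assumes [measurable]: "f \<in> borel_measurable borel" "h \<in> borel_measurable borel"
  shows "(\<integral>\<^sup>+x\<in>{0<..<1}. f x * h (gauss_map x) \<partial>lborel)
    = (\<integral>\<^sup>+y\<in>{0<..<1}. (\<Sum>k. ennreal (1 / (real k + 1 + y)^2) * f (1 / (real k + 1 + y))) * h y \<partial>lborel)"
proof -
  define F where "F = (\<lambda>x. f x * h (gauss_map x))"
  have [measurable]: "F \<in> borel_measurable borel" unfolding F_def by measurable
  define I where "I = (\<lambda>k::nat. {1 / (real k + 2)<..<1 / (real k + 1)})"
  have AE: "AE x in lborel. x \<notin> range (\<lambda>k::nat. 1 / (real k + 1))"
    by (intro AE_not_in countable_imp_null_set_lborel countable_image) simp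
  have split: "indicator {0<..<1} x = (\<Sum>k. indicator (I k) x :: ennreal)"
    if x: "x \<notin> range (\<lambda>k::nat. 1 / (real k + 1))" for x :: real
  proof -
    have disj: "disjoint_family I"
    proof -
      have "I i \<inter> I j = {}" if "i < j" for i j
      proof -
        have "1 / (real j + 1) \<le> 1 / (real i + 2)" using that by (intro divide_left_mono) auto
        then show ?thesis by (auto simp: I_def)
      qed
      then show ?thesis by (metis disjoint_family_on_def inf_commute linorder_neqE_nat)
    qed
    have "x \<in> {0<..<1} \<longleftrightarrow> x \<in> (\<Union>k. I k)"
    proof
      assume x01: "x \<in> {0<..<1}"
      define k where "k = nat \<lfloor>1 / x\<rfloor> - 1"
      have "\<lfloor>1 / x\<rfloor> \<ge> 1" using x01 by (simp add: le_floor_iff)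
      then have "int k + 1 = \<lfloor>1 / x\<rfloor>" unfolding k_def by arith
      then have k: "real k + 1 = of_int \<lfloor>1 / x\<rfloor>" by linarith
      have "real k + 1 \<le> 1 / x" "1 / x < real k + 2"
        using of_int_floor_le[of "1 / x"] floor_correct[of "1 / x"] k by linarith+
      moreover have "x \<noteq> 1 / (real k + 1)" using x by auto
      ultimately have "x \<in> I k" using x01 by (auto simp: I_def field_simps)
      then show "x \<in> (\<Union>k. I k)" by blast
    next
      assume "x \<in> (\<Union>k. I k)"
      then obtain k where k: "1 / (real k + 2) < x" "x < 1 / (real k + 1)" by (auto simp: I_def)
      moreover have "0 < 1 / (real k + 2)" "1 / (real k + 1) \<le> 1" by auto
      ultimately show "x \<in> {0<..<1}" unfolding greaterThanLessThan_iff by linarith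
    qed
    then have "indicator {0<..<1} x = (indicator (\<Union>k. I k) x :: ennreal)"
      by (simp only: indicator_def)
    then show ?thesis by (simp only: suminf_indicator[OF disj])
  qed
  have branch: "(\<integral>\<^sup>+x. F x * indicator (I k) x \<partial>lborel)
     = (\<integral>\<^sup>+y\<in>{0<..<1}. (ennreal (1 / (real k + 1 + y)^2) * f (1 / (real k + 1 + y))) * h y \<partial>lborel)" for k
  proof -
    have "(\<integral>\<^sup>+x. F x * indicator (I k) x \<partial>lborel) =
      (\<integral>\<^sup>+ s. ennreal (\<bar>0 * (real k + 1) - 1 * 1\<bar> / ((real k + 1) + 1 * s)^2) *
        (F ((1 + 0 * s) / ((real k + 1) + 1 * s)) * indicator (I k) ((1 + 0 * s) / ((real k + 1) + 1 * s))) \<partial>lborel)"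
      by (rule nn_integral_moebius[symmetric]) (auto simp: I_def)
    also have "\<dots> = (\<integral>\<^sup>+y\<in>{0<..<1}. (ennreal (1 / (real k + 1 + y)^2) * f (1 / (real k + 1 + y))) * h y \<partial>lborel)"
    proof (rule nn_integral_cong)
      fix s :: real
      have "1 / (real k + 1 + s) \<in> I k \<longleftrightarrow> s \<in> {0<..<1}"
      proof (cases "real k + 1 + s > 0")
        case True
        then show ?thesis by (auto simp: I_def field_simps)
      next
        case False
        then have "1 / (real k + 1 + s) \<le> 0" by (simp add: divide_nonneg_nonpos)
        moreover have "0 < 1 / (real k + 2)" by simp
        ultimately have "1 / (real k + 1 + s) \<notin> I k"
          unfolding I_def greaterThanLessThan_iff by linarith
        then show ?thesis using False by auto
      qed
      moreover have "gauss_map (1 / (real k + 1 + s)) = s" if "s \<in> {0<..<1}"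
      proof -
        have "frac (real k + 1 + s) = s"
          using that by (subst frac_unique_iff) simp
        then show ?thesis by (simp add: gauss_map_def)
      qed
      ultimately show "ennreal (\<bar>0 * (real k + 1) - 1 * 1\<bar> / ((real k + 1) + 1 * s)^2) *
        (F ((1 + 0 * s) / ((real k + 1) + 1 * s)) * indicator (I k) ((1 + 0 * s) / ((real k + 1) + 1 * s)))
        = (ennreal (1 / (real k + 1 + s)^2) * f (1 / (real k + 1 + s))) * h s * indicator {0<..<1} s"
        by (auto simp: F_def indicator_def mult.assoc)
    qed
    finally show ?thesis .
  qed
  have "(\<integral>\<^sup>+x\<in>{0<..<1}. f x * h (gauss_map x) \<partial>lborel)
      = (\<integral>\<^sup>+x. (\<Sum>k. F x * indicator (I k) x) \<partial>lborel)"
  proof (rule nn_integral_cong_AE, use AE in eventually_elim)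
    fix x assume x: "x \<notin> range (\<lambda>k::nat. 1 / (real k + 1))"
    show "f x * h (gauss_map x) * indicator {0<..<1} x = (\<Sum>k. F x * indicator (I k) x)"
      by (simp only: split[OF x] F_def ennreal_suminf_cmult)
  qed
  also have "\<dots> = (\<Sum>k. \<integral>\<^sup>+x. F x * indicator (I k) x \<partial>lborel)"
    by (rule nn_integral_suminf) (simp add: I_def)
  also have "\<dots> = (\<Sum>k. \<integral>\<^sup>+y\<in>{0<..<1}. (ennreal (1 / (real k + 1 + y)^2) * f (1 / (real k + 1 + y))) * h y \<partial>lborel)"
    by (simp only: branch)
  also have "\<dots> = (\<integral>\<^sup>+y. (\<Sum>k. (ennreal (1 / (real k + 1 + y)^2) * f (1 / (real k + 1 + y))) * h y * indicator {0<..<1} y) \<partial>lborel)"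
    by (rule nn_integral_suminf[symmetric]) simp
  also have "\<dots> = (\<integral>\<^sup>+y\<in>{0<..<1}. (\<Sum>k. ennreal (1 / (real k + 1 + y)^2) * f (1 / (real k + 1 + y))) * h y \<partial>lborel)"
    by (simp only: ennreal_suminf_multc)
  finally show ?thesis .
qed

text \<open>
  The transfer operator written for densities with respect to the invariant measure \<open>dx / (1 + x)\<close>; the
  index \<open>k\<close> stands for the digit \<open>k + 1\<close>.
\<close>

definition gk_weight :: "nat \<Rightarrow> real \<Rightarrow> real" where
  "gk_weight k y = (1 + y) / ((real k + 1 + y) * (real k + 2 + y))"

definition gk_op :: "(real \<Rightarrow> real) \<Rightarrow> real \<Rightarrow> real" where
  "gk_op g y = (\<Sum>k. gk_weight k y * g (1 / (real k + 1 + y)))"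

text \<open>
  The tail sums of the weights: they telescope.
\<close>

definition gk_tail :: "nat \<Rightarrow> real \<Rightarrow> real" where
  "gk_tail k y = (1 + y) / (real k + 1 + y)"

lemma gk_weight_tail: "y \<ge> 0 \<Longrightarrow> gk_weight k y = gk_tail k y - gk_tail (Suc k) y"
  by (simp add: gk_weight_def gk_tail_def field_simps)

lemma gk_weight_nonneg: "y \<ge> 0 \<Longrightarrow> gk_weight k y \<ge> 0"
  by (simp add: gk_weight_def)

lemma gk_weight_sums: 
  assumes "y \<ge> 0"
  shows "(\<lambda>k. gk_weight k y) sums 1"
proof -
  have "filterlim (\<lambda>k. (1 + y) + real k) at_top sequentially"
    by (rule filterlim_tendsto_add_at_top[OF tendsto_const filterlim_real_sequentially])
  then have "(\<lambda>k. (1 + y) / ((1 + y) + real k)) \<longlonglongrightarrow> 0"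
    by (rule real_tendsto_divide_at_top[OF tendsto_const])
  then have "(\<lambda>k. gk_tail k y) \<longlonglongrightarrow> 0" by (simp add: gk_tail_def add_ac)
  then have "(\<lambda>k. gk_tail k y - gk_tail (Suc k) y) sums (gk_tail 0 y - 0)"
    by (rule telescope_sums')
  then show ?thesis using assms by (simp add: gk_weight_tail) (simp add: gk_tail_def)
qed

lemma inverse_in_unit_interval: "y \<ge> 0 \<Longrightarrow> 1 / (real k + 1 + y) \<in> {0..1}"
  by simp

lemma gk_op_summable:
  assumes g: "\<And>x. x \<in> {0..1} \<Longrightarrow> \<bar>g x\<bar> \<le> B" and y: "y \<ge> 0"
  shows "summable (\<lambda>k. gk_weight k y * g (1 / (real k + 1 + y)))"
proof (rule summable_comparison_test)
  show "summable (\<lambda>k. gk_weight k y * B)"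
    using gk_weight_sums[OF y] by (intro summable_mult2) (rule sums_summable)
  show "\<exists>N. \<forall>n\<ge>N. norm (gk_weight n y * g (1 / (real n + 1 + y))) \<le> gk_weight n y * B"
    using g[OF inverse_in_unit_interval[OF y]] gk_weight_nonneg[OF y]
    by (auto simp: abs_mult intro!: mult_left_mono)
qed

lemma abel_summation:
  fixes W c :: "nat \<Rightarrow> real"
  shows "(\<Sum>k<N. (W k - W (Suc k)) * c k) =
         W 0 * c 0 - W N * c N - (\<Sum>k<N. W (Suc k) * (c k - c (Suc k)))"
  by (induction N) (simp_all add: algebra_simps)

text \<open>
  All tail sums of the weights increase with \<open>y\<close>, that is, the weights at \<open>y\<close> dominate those at \<open>x\<close>
  stochastically; by Abel summation the average of a decreasing sequence decreases.
\<close>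

lemma gk_weight_dominance:
  assumes c: "decseq c" "\<And>k. c k \<ge> 0" and xy: "0 \<le> x" "x \<le> y"
    and sm: "summable (\<lambda>k. gk_weight k x * c k)" "summable (\<lambda>k. gk_weight k y * c k)"
  shows "(\<Sum>k. gk_weight k y * c k) \<le> (\<Sum>k. gk_weight k x * c k)"
proof (rule LIMSEQ_le)
  show "(\<lambda>n. \<Sum>k<n. gk_weight k y * c k) \<longlonglongrightarrow> (\<Sum>k. gk_weight k y * c k)"
    "(\<lambda>n. \<Sum>k<n. gk_weight k x * c k) \<longlonglongrightarrow> (\<Sum>k. gk_weight k x * c k)"
    using sm by (auto intro: summable_LIMSEQ)
  have tail: "gk_tail k x \<le> gk_tail k y" for k
  proof -
    have "1 - real k / (real k + 1 + x) \<le> 1 - real k / (real k + 1 + y)"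
      using xy by (intro diff_left_mono divide_left_mono) auto
    then show ?thesis using xy by (simp add: gk_tail_def field_simps)
  qed
  have "(\<Sum>k<N. gk_weight k y * c k) \<le> (\<Sum>k<N. gk_weight k x * c k)" for N
  proof -
    have "gk_tail N x * c N \<le> gk_tail N y * c N"
      using tail c(2) by (intro mult_right_mono)
    moreover have "(\<Sum>k<N. gk_tail (Suc k) x * (c k - c (Suc k))) \<le> (\<Sum>k<N. gk_tail (Suc k) y * (c k - c (Suc k)))"
      using tail c(1) by (intro sum_mono mult_right_mono) (auto simp: decseq_Suc_iff)
    moreover have "(\<Sum>k<N. gk_weight k z * c k) =
        c 0 - gk_tail N z * c N - (\<Sum>k<N. gk_tail (Suc k) z * (c k - c (Suc k)))" if "z \<ge> 0" for z
    proof -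
      have "gk_tail 0 z = 1" using that by (simp add: gk_tail_def)
      then show ?thesis
        using abel_summation[of "\<lambda>k. gk_tail k z" c N] that by (simp only: gk_weight_tail mult_1)
    qed
    ultimately show ?thesis using xy by simp
  qed
  then show "\<exists>N. \<forall>n\<ge>N. (\<Sum>k<n. gk_weight k y * c k) \<le> (\<Sum>k<n. gk_weight k x * c k)" by blast
qed

lemma gk_op_const_minus:
  assumes g: "\<And>x. x \<in> {0..1} \<Longrightarrow> \<bar>g x\<bar> \<le> B" and y: "y \<ge> 0"
  shows "gk_op (\<lambda>x. C - g x) y = C - gk_op g y"
proof -
  have "(\<lambda>k. gk_weight k y * C - gk_weight k y * g (1 / (real k + 1 + y))) sums (1 * C - gk_op g y)"
    unfolding gk_op_def
    by (intro sums_diff sums_mult2 gk_weight_sums y summable_sums gk_op_summable[of g B]) (use g in auto)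
  then show ?thesis by (simp add: gk_op_def sums_iff right_diff_distrib)
qed

lemma gk_op_bounds:
  assumes g: "\<And>x. x \<in> {0..1} \<Longrightarrow> m \<le> g x \<and> g x \<le> M" and y: "y \<ge> 0"
  shows "m \<le> gk_op g y \<and> gk_op g y \<le> M"
proof -
  have b: "\<bar>g x\<bar> \<le> \<bar>m\<bar> + \<bar>M\<bar>" if "x \<in> {0..1}" for x using g[OF that] by linarith
  have s: "(\<lambda>k. gk_weight k y * g (1 / (real k + 1 + y))) sums gk_op g y"
    unfolding gk_op_def by (intro summable_sums gk_op_summable[of g "\<bar>m\<bar> + \<bar>M\<bar>"] b y)
  have c: "(\<lambda>k. gk_weight k y * c) sums c" for c
    using sums_mult2[OF gk_weight_sums[OF y], of c] by simp
  have *: "gk_weight k y * m \<le> gk_weight k y * g (1 / (real k + 1 + y))"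
    "gk_weight k y * g (1 / (real k + 1 + y)) \<le> gk_weight k y * M" for k
    using g[OF inverse_in_unit_interval[OF y]] gk_weight_nonneg[OF y] by (auto intro: mult_left_mono)
  show ?thesis using sums_le[OF *(1) c s] sums_le[OF *(2) s c] by blast
qed

text \<open>
  Two effects act in the same direction: the arguments \<open>1 / (k + 1 + y)\<close> decrease with \<open>y\<close>, and the weight
  moves to larger \<open>k\<close>, hence to smaller arguments.
\<close>

lemma gk_op_antimono:
  assumes g: "mono_on {0..1} g" "\<And>x. x \<in> {0..1} \<Longrightarrow> 0 \<le> g x \<and> g x \<le> B"
  shows "antimono_on {0..1} (gk_op g)"
proof (rule monotone_onI)
  fix x y :: real assume xy: "x \<in> {0..1}" "y \<in> {0..1}" "x \<le> y"
  then have xy': "0 \<le> x" "0 \<le> y" by auto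
  have g': "\<bar>g x\<bar> \<le> B" if "x \<in> {0..1}" for x using g(2)[OF that] by auto
  define c where "c = (\<lambda>k::nat. g (1 / (real k + 1 + x)))"
  have c0: "c k \<ge> 0" for k using g(2)[OF inverse_in_unit_interval[OF xy'(1)]] by (simp add: c_def)
  have cB: "\<bar>c k\<bar> \<le> B" for k using g'[OF inverse_in_unit_interval[OF xy'(1)]] by (simp add: c_def)
  have dec: "decseq c"
    unfolding decseq_Suc_iff c_def
    using xy' by (intro allI mono_onD[OF g(1)] inverse_in_unit_interval divide_left_mono) auto
  have sm: "summable (\<lambda>k. gk_weight k z * c k)" if "z \<ge> 0" for z
  proof (rule summable_comparison_test)
    show "summable (\<lambda>k. gk_weight k z * B)"
      using gk_weight_sums[OF that] by (intro summable_mult2) (rule sums_summable)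
    show "\<exists>N. \<forall>n\<ge>N. norm (gk_weight n z * c n) \<le> gk_weight n z * B"
      using cB gk_weight_nonneg[OF that] by (auto simp: abs_mult intro!: mult_left_mono)
  qed
  have "gk_op g y \<le> (\<Sum>k. gk_weight k y * c k)"
    unfolding gk_op_def
  proof (rule suminf_le)
    fix k
    have "g (1 / (real k + 1 + y)) \<le> c k"
      unfolding c_def using xy xy'
      by (intro mono_onD[OF g(1)] inverse_in_unit_interval divide_left_mono) auto
    then show "gk_weight k y * g (1 / (real k + 1 + y)) \<le> gk_weight k y * c k"
      using gk_weight_nonneg[OF xy'(2)] by (rule mult_left_mono)
  qed (use sm xy' gk_op_summable[OF g'] in auto)
  also have "\<dots> \<le> (\<Sum>k. gk_weight k x * c k)"
    by (rule gk_weight_dominance[OF dec c0 xy'(1) xy(3) sm[OF xy'(1)] sm[OF xy'(2)]])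
  also have "\<dots> = gk_op g x" by (simp add: gk_op_def c_def)
  finally show "gk_op g x \<ge> gk_op g y" .
qed

lemma gk_op_mono:
  assumes g: "antimono_on {0..1} g" "\<And>x. x \<in> {0..1} \<Longrightarrow> 0 \<le> g x \<and> g x \<le> B"
  shows "mono_on {0..1} (gk_op g)"
proof -
  have "mono_on {0..1} (\<lambda>x. B - g x)"
    using g(1) by (auto simp: monotone_on_def)
  then have "antimono_on {0..1} (gk_op (\<lambda>x. B - g x))"
    by (rule gk_op_antimono[where B=B]) (use g(2) in auto)
  moreover have "gk_op (\<lambda>x. B - g x) y = B - gk_op g y" if "y \<in> {0..1}" for y
    using that g(2) by (intro gk_op_const_minus[of g B]) auto
  ultimately show ?thesis by (auto simp: monotone_on_def)
qed

text \<open>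
  The series at \<open>1\<close> is, up to the factor \<open>2\<close>, the series at \<open>0\<close> without its first term \<open>g 1 / 2\<close>. So
  \<open>gk_op g 1 - gk_op g 0\<close> equals \<open>gk_op g 0 - g 1\<close>, which is the remainder of the series at \<open>0\<close>, of total
  weight one half, minus \<open>g 1 / 2\<close>.
\<close>

lemma gk_op_oscillation:
  assumes g: "\<And>x. x \<in> {0..1} \<Longrightarrow> min (g 0) (g 1) \<le> g x \<and> g x \<le> max (g 0) (g 1)"
  shows "\<bar>gk_op g 1 - gk_op g 0\<bar> \<le> \<bar>g 1 - g 0\<bar> / 2"
proof -
  define m M where "m = min (g 0) (g 1)" and "M = max (g 0) (g 1)"
  have b: "\<bar>g x\<bar> \<le> \<bar>m\<bar> + \<bar>M\<bar>" if "x \<in> {0..1}" for x using g[OF that] unfolding m_def M_def by linarith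
  define t where "t = (\<lambda>k::nat. gk_weight k 0 * g (1 / (real k + 1 + 0)))"
  have t: "t sums gk_op g 0"
    unfolding gk_op_def t_def by (intro summable_sums gk_op_summable[of g "\<bar>m\<bar> + \<bar>M\<bar>"] b) auto
  have t0: "t 0 = g 1 / 2" by (simp add: t_def gk_weight_def)
  have tS: "(\<lambda>k. t (Suc k)) sums (gk_op g 0 - g 1 / 2)" using t by (subst sums_Suc_iff) (simp add: t0)
  have "gk_weight k 1 * g (1 / (real k + 1 + 1)) = 2 * t (Suc k)" for k
    by (simp add: t_def gk_weight_def field_simps)
  then have "gk_op g 1 = 2 * (gk_op g 0 - g 1 / 2)"
    using sums_mult[OF tS, of 2] by (simp add: gk_op_def sums_iff)
  moreover have "m / 2 \<le> gk_op g 0 - g 1 / 2 \<and> gk_op g 0 - g 1 / 2 \<le> M / 2"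
  proof -
    have "(\<lambda>k. gk_weight (Suc k) 0) sums (1 - gk_weight 0 0)"
      using gk_weight_sums[of 0] by (subst sums_Suc_iff) simp
    then have w: "(\<lambda>k. gk_weight (Suc k) 0) sums (1 / 2)" by (simp add: gk_weight_def)
    have c: "(\<lambda>k. gk_weight (Suc k) 0 * c) sums (c / 2)" for c
      using sums_mult2[OF w, of c] by simp
    have *: "gk_weight (Suc k) 0 * m \<le> t (Suc k)" "t (Suc k) \<le> gk_weight (Suc k) 0 * M" for k
      using g[OF inverse_in_unit_interval[of 0 "Suc k"]] gk_weight_nonneg[of 0 "Suc k"]
      unfolding t_def m_def M_def by (auto intro!: mult_left_mono)
    show ?thesis using sums_le[OF *(1) c tS] sums_le[OF *(2) tS c] by blast
  qed
  ultimately show ?thesis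
    unfolding m_def M_def by (cases "g 0 \<le> g 1") (simp_all add: abs_le_iff field_simps)
qed

text \<open>
  The density of the \<open>n\<close>-th iterate of the Gauss map with respect to \<open>dx / (1 + x)\<close>; the initial
  value \<open>1 + x\<close> represents Lebesgue measure.
\<close>

definition gk_density :: "nat \<Rightarrow> real \<Rightarrow> real" where
  "gk_density n = (gk_op ^^ n) (\<lambda>x. 1 + x)"

lemma gk_density_Suc: "gk_density (Suc n) = gk_op (gk_density n)"
  by (simp add: gk_density_def)

lemma gk_density_monotone:
  "(mono_on {0..1} (gk_density n) \<or> antimono_on {0..1} (gk_density n)) \<and>
   (\<forall>x\<in>{0..1}. 1 \<le> gk_density n x \<and> gk_density n x \<le> 2)"
proof (induction n)
  case 0
  then show ?case by (auto simp: gk_density_def monotone_on_def)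
next
  case (Suc n)
  have b: "0 \<le> gk_density n x \<and> gk_density n x \<le> 2" if "x \<in> {0..1}" for x
  proof -
    have "1 \<le> gk_density n x \<and> gk_density n x \<le> 2" using Suc that by blast
    then show ?thesis by linarith
  qed
  have "mono_on {0..1} (gk_density (Suc n)) \<or> antimono_on {0..1} (gk_density (Suc n))"
    using Suc gk_op_mono[OF _ b] gk_op_antimono[OF _ b] by (auto simp: gk_density_Suc)
  moreover have "1 \<le> gk_density (Suc n) x \<and> gk_density (Suc n) x \<le> 2" if "x \<in> {0..1}" for x
    unfolding gk_density_Suc using Suc that by (intro gk_op_bounds) auto
  ultimately show ?case by blast
qed

lemma gk_density_between:
  assumes "x \<in> {0..1}"
  shows "min (gk_density n 0) (gk_density n 1) \<le> gk_density n x \<and>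
         gk_density n x \<le> max (gk_density n 0) (gk_density n 1)"
proof -
  have "gk_density n 0 \<le> gk_density n x \<and> gk_density n x \<le> gk_density n 1 \<or>
        gk_density n 1 \<le> gk_density n x \<and> gk_density n x \<le> gk_density n 0"
    using gk_density_monotone[of n] assms
    by (auto dest: monotone_onD[of _ _ _ _ 0 x] monotone_onD[of _ _ _ _ x 1])
  then show ?thesis by (auto simp: min_le_iff_disj le_max_iff_disj)
qed

lemma gk_density_oscillation: "\<bar>gk_density n 1 - gk_density n 0\<bar> \<le> (1 / 2) ^ n"
proof (induction n)
  case (Suc n)
  have "\<bar>gk_density (Suc n) 1 - gk_density (Suc n) 0\<bar> \<le> \<bar>gk_density n 1 - gk_density n 0\<bar> / 2"
    unfolding gk_density_Suc by (rule gk_op_oscillation) (rule gk_density_between)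
  then show ?case using Suc by simp
qed (simp add: gk_density_def)

lemma gk_density_measurable [measurable]: "gk_density n \<in> borel_measurable borel"
proof (induction n)
  case (Suc n)
  note Suc[measurable]
  have "gk_op (gk_density n) \<in> borel_measurable borel"
    unfolding gk_op_def gk_weight_def by measurable
  then show ?case by (simp add: gk_density_Suc)
qed (simp add: gk_density_def)

lemma gk_density_transfer:
  fixes h :: "real \<Rightarrow> ennreal"
  assumes "h \<in> borel_measurable borel"
  shows "(\<integral>\<^sup>+x\<in>{0<..<1}. h ((gauss_map ^^ n) x) \<partial>lborel)
       = (\<integral>\<^sup>+y\<in>{0<..<1}. ennreal (gk_density n y / (1 + y)) * h y \<partial>lborel)"
  using assms
proof (induction n arbitrary: h)
  case 0
  show ?case by (rule nn_integral_cong) (auto simp: gk_density_def indicator_def)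
next
  case (Suc n)
  note [measurable] = Suc.prems
  define f where "f = (\<lambda>x. ennreal (gk_density n x / (1 + x)))"
  have [measurable]: "f \<in> borel_measurable borel" unfolding f_def by measurable
  have b: "1 \<le> gk_density n x \<and> gk_density n x \<le> 2" if "x \<in> {0..1}" for x
    using gk_density_monotone that by blast
  have op: "(\<Sum>k. ennreal (1 / (real k + 1 + y)^2) * f (1 / (real k + 1 + y)))
      = ennreal (gk_density (Suc n) y / (1 + y))" if y: "y \<in> {0<..<1}" for y
  proof -
    define t where "t = (\<lambda>k::nat. gk_weight k y * gk_density n (1 / (real k + 1 + y)) / (1 + y))"
    have y0: "y \<ge> 0" using y by simp
    have pos: "0 \<le> gk_density n (1 / (real k + 1 + y))" for k
      using b[OF inverse_in_unit_interval[OF y0, of k]] by linarith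
    have "ennreal (1 / (real k + 1 + y)^2) * f (1 / (real k + 1 + y)) = ennreal (t k)" for k
    proof -
      have "1 / (real k + 1 + y)^2 * (gk_density n (1 / (real k + 1 + y)) / (1 + 1 / (real k + 1 + y))) = t k"
      proof -
        have cancel: "1 / A^2 * (G / (1 + 1 / A)) = (1 + y) / (A * (A + 1)) * G / (1 + y)"
          if "A > 0" for A G :: real
        proof -
          have "1 + 1 / A = (A + 1) / A" using that by (simp add: field_simps)
          then show ?thesis using that y by (simp add: power2_eq_square)
        qed
        have "real k + 2 + y = (real k + 1 + y) + 1" by simp
        then show ?thesis unfolding t_def gk_weight_def
          using cancel[of "real k + 1 + y"] y by (simp only:) simp
      qed
      then show ?thesis unfolding f_def using y0 by (simp flip: ennreal_mult')
    qed
    moreover have "t k \<ge> 0" for k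
      using pos gk_weight_nonneg[OF y0] y0 by (simp add: t_def)
    moreover have "summable (\<lambda>k. gk_weight k y * gk_density n (1 / (real k + 1 + y)))"
      by (rule gk_op_summable[of _ 2]) (use b y0 in force)+
    ultimately show ?thesis
      by (simp add: suminf_ennreal2 t_def summable_divide suminf_divide[symmetric] gk_density_Suc gk_op_def)
  qed
  have "(\<integral>\<^sup>+x\<in>{0<..<1}. h ((gauss_map ^^ Suc n) x) \<partial>lborel)
     = (\<integral>\<^sup>+x\<in>{0<..<1}. (\<lambda>x. h (gauss_map x)) ((gauss_map ^^ n) x) \<partial>lborel)" by simp
  also have "\<dots> = (\<integral>\<^sup>+y\<in>{0<..<1}. f y * h (gauss_map y) \<partial>lborel)"
    unfolding f_def by (rule Suc.IH) measurable
  also have "\<dots> = (\<integral>\<^sup>+y\<in>{0<..<1}. (\<Sum>k. ennreal (1 / (real k + 1 + y)^2) * f (1 / (real k + 1 + y))) * h y \<partial>lborel)"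
    by (rule nn_integral_gauss_map) measurable
  also have "\<dots> = (\<integral>\<^sup>+y\<in>{0<..<1}. ennreal (gk_density (Suc n) y / (1 + y)) * h y \<partial>lborel)"
    by (rule nn_integral_cong) (simp add: op indicator_def)
  finally show ?case .
qed

section \<open>The Gauss--Kuzmin theorem\<close>

lemma nn_integral_inverse_1_plus:
  assumes "0 \<le> a" "a \<le> b" "c \<ge> 0"
  shows "(\<integral>\<^sup>+y\<in>{a<..<b}. ennreal (c / (1 + y)) \<partial>lborel) = ennreal (c * ln ((1 + b) / (1 + a)))"
proof -
  have "((\<lambda>y. c / (1 + y)) has_integral c * ln (1 + b) - c * ln (1 + a)) {a..b}"
    using assms
    by (intro fundamental_theorem_of_calculus)
       (auto intro!: derivative_eq_intros simp: has_real_derivative_iff_has_vector_derivative[symmetric])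
  then have "((\<lambda>y. c / (1 + y)) has_integral c * ln ((1 + b) / (1 + a))) {a<..<b}"
    using assms by (simp add: has_integral_Icc_iff_Ioo ln_div right_diff_distrib)
  then show ?thesis using assms by (intro nn_integral_has_integral_lebesgue') auto
qed

text \<open>
  As the total mass is one and the integral of \<open>1 / (1 + x)\<close> is \<open>ln 2\<close>, the number \<open>1 / ln 2\<close> is an average of
  the density and so lies between its extreme values, which are close to each other.
\<close>

lemma gk_density_near_limit:
  assumes "x \<in> {0..1}"
  shows "\<bar>gk_density n x - 1 / ln 2\<bar> \<le> (1 / 2) ^ n"
proof -
  define m M where "m = min (gk_density n 0) (gk_density n 1)" and "M = max (gk_density n 0) (gk_density n 1)"
  have mM: "m \<le> gk_density n x \<and> gk_density n x \<le> M" if "x \<in> {0..1}" for x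
    unfolding m_def M_def by (rule gk_density_between[OF that])
  have m0: "m \<ge> 0" "M \<ge> 0" 
  proof -
    have "1 \<le> gk_density n 0" "1 \<le> gk_density n 1" using gk_density_monotone[of n] by auto
    then show "m \<ge> 0" "M \<ge> 0" unfolding m_def M_def by linarith+
  qed
  have tot: "(\<integral>\<^sup>+y\<in>{0<..<1}. ennreal (gk_density n y / (1 + y)) \<partial>lborel) = 1"
    using gk_density_transfer[of "\<lambda>_. 1" n] by simp
  have c: "(\<integral>\<^sup>+y\<in>{0<..<1}. ennreal (c / (1 + y)) \<partial>lborel) = ennreal (c * ln 2)" if "c \<ge> 0" for c
    using nn_integral_inverse_1_plus[of 0 1 c] that by simp
  have "ennreal (m * ln 2) \<le> 1"
    unfolding tot[symmetric] c[OF m0(1), symmetric] using mM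
    by (intro nn_integral_mono) (auto simp: indicator_def intro!: ennreal_leI divide_right_mono)
  moreover have "1 \<le> ennreal (M * ln 2)"
    unfolding tot[symmetric] c[OF m0(2), symmetric] using mM
    by (intro nn_integral_mono) (auto simp: indicator_def intro!: ennreal_leI divide_right_mono)
  ultimately have "m * ln 2 \<le> 1" "1 \<le> M * ln 2" by auto
  then have "m \<le> 1 / ln 2" "1 / ln 2 \<le> M" by (auto simp: field_simps)
  moreover have "M - m \<le> (1 / 2) ^ n"
    using gk_density_oscillation[of n] by (auto simp: m_def M_def)
  ultimately show ?thesis using mM[OF assms] by linarith
qed

lemma gauss_kuzmin_measure_Suc:
  assumes "k > 0"
  shows "ennreal (gauss_kuzmin_measure (Suc n) k) =
    (\<integral>\<^sup>+y\<in>{1 / (real k + 1)<..<1 / real k}. ennreal (gk_density n y / (1 + y)) \<partial>lborel)"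
proof -
  define D where "D = {y::real. nat \<lfloor>1 / y\<rfloor> = k}"
  have [measurable]: "D \<in> sets borel" unfolding D_def by measurable
  define A where "A = {\<alpha> \<in> {0<..<1}. (gauss_map ^^ n) \<alpha> \<in> D}"
  have [measurable]: "(gauss_map ^^ n) \<in> borel_measurable borel"
    by (induction n) (simp_all add: o_def id_def)
  have [measurable]: "A \<in> sets borel" unfolding A_def by measurable
  have fin: "emeasure lborel (A - \<rat>) \<noteq> \<infinity>"
  proof -
    have "emeasure lborel (A - \<rat>) \<le> emeasure lborel {0<..<1::real}"
      by (rule emeasure_mono) (auto simp: A_def)
    then show ?thesis by (auto simp: top_unique)
  qed
  have Q: "(\<rat> :: real set) \<in> null_sets lborel"
    by (rule countable_imp_null_set_lborel) (rule countable_rat)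
  have "gauss_kuzmin_measure (Suc n) k = measure lebesgue (A - \<rat>)"
    unfolding gauss_kuzmin_measure_def cf_digit_set_eq
    by (rule arg_cong[of _ _ "measure lebesgue"]) (auto simp: A_def D_def cf_digit_def)
  also have "\<dots> = measure lborel (A - \<rat>)"
    using Q by (intro measure_completion) auto
  finally have "ennreal (gauss_kuzmin_measure (Suc n) k) = emeasure lborel (A - \<rat>)"
    using fin by (simp add: emeasure_eq_ennreal_measure)
  also have "\<dots> = emeasure lborel A" by (rule emeasure_Diff_null_set) (use Q in auto)
  also have "\<dots> = (\<integral>\<^sup>+x\<in>{0<..<1}. indicator D ((gauss_map ^^ n) x) \<partial>lborel)"
    by (subst nn_integral_indicator[symmetric], simp, rule nn_integral_cong)
       (auto simp: A_def indicator_def)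
  also have "\<dots> = (\<integral>\<^sup>+y\<in>{0<..<1}. ennreal (gk_density n y / (1 + y)) * indicator D y \<partial>lborel)"
    by (rule gk_density_transfer) simp
  also have "\<dots> = (\<integral>\<^sup>+y\<in>{1 / (real k + 1)<..<1 / real k}. ennreal (gk_density n y / (1 + y)) \<partial>lborel)"
  proof (rule nn_integral_cong_AE)
    have "AE y in lborel. y \<notin> {1 / real k, 1}"
      by (intro AE_not_in countable_imp_null_set_lborel) simp
    then show "AE y in lborel. ennreal (gk_density n y / (1 + y)) * indicator D y * indicator {0<..<1} y
      = ennreal (gk_density n y / (1 + y)) * indicator {1 / (real k + 1)<..<1 / real k} y"
    proof eventually_elim
      fix y :: real assume y: "y \<notin> {1 / real k, 1}"
      have "y \<in> D \<and> y \<in> {0<..<1} \<longleftrightarrow> y \<in> {1 / (real k + 1)<..<1 / real k}"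
      proof (cases "y > 0")
        case True
        have "y \<in> D \<longleftrightarrow> \<lfloor>1 / y\<rfloor> = int k" using assms by (auto simp: D_def)
        also have "\<dots> \<longleftrightarrow> real k \<le> 1 / y \<and> 1 / y < real k + 1" by (simp add: floor_eq_iff)
        also have "\<dots> \<longleftrightarrow> y \<le> 1 / real k \<and> 1 / (real k + 1) < y"
          using True assms by (auto simp: field_simps)
        finally have "y \<in> D \<longleftrightarrow> y \<in> {1 / (real k + 1)<..<1 / real k}" using y by auto
        moreover have "1 / real k \<le> 1" using assms by simp
        ultimately show ?thesis using True y by auto
      next
        case False
        moreover have "0 < 1 / (real k + 1)" by simp
        ultimately show ?thesis unfolding greaterThanLessThan_iff by linarith
      qed
      then show "ennreal (gk_density n y / (1 + y)) * indicator D y * indicator {0<..<1} y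
      = ennreal (gk_density n y / (1 + y)) * indicator {1 / (real k + 1)<..<1 / real k} y"
        by (auto simp: indicator_def)
    qed
  qed
  finally show ?thesis .
qed

lemma gauss_kuzmin_theorem:
  assumes k: "k > 0"
  shows "(\<lambda>n. gauss_kuzmin_measure n k) \<longlonglongrightarrow> ln ((real k + 1)^2 / (real k * (real k + 2))) / ln 2"
proof -
  define I where "I = {1 / (real k + 1)<..<1 / real k}"
  define J where "J = ln ((real k + 1)^2 / (real k * (real k + 2)))"
  have I01: "x \<in> {0..1}" if "x \<in> I" for x
  proof -
    have "0 < 1 / (real k + 1)" "1 / real k \<le> 1" using k by auto
    then show ?thesis using that unfolding I_def greaterThanLessThan_iff atLeastAtMost_iff by linarith
  qed
  have "(1 + 1 / real k) / (1 + 1 / (real k + 1)) = (real k + 1)^2 / (real k * (real k + 2))"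
  proof -
    have "1 + 1 / real k = (real k + 1) / real k" "1 + 1 / (real k + 1) = (real k + 2) / (real k + 1)"
      using k by (simp_all add: field_simps)
    then show ?thesis by (simp add: power2_eq_square)
  qed
  then have c: "(\<integral>\<^sup>+y\<in>I. ennreal (c / (1 + y)) \<partial>lborel) = ennreal (c * J)" if "c \<ge> 0" for c
    using nn_integral_inverse_1_plus[of "1 / (real k + 1)" "1 / real k" c] that k
    by (simp add: I_def J_def frac_le)
  have J0: "J \<ge> 0" unfolding J_def 
  proof (rule ln_ge_zero)
    have "real k * (real k + 2) \<le> (real k + 1)^2" by (simp add: power2_eq_square algebra_simps)
    moreover have "0 < real k * (real k + 2)" using k by simp
    ultimately show "1 \<le> (real k + 1)^2 / (real k * (real k + 2))" by (simp only: le_divide_eq_1_pos)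
  qed
  have ln2: "1 / ln 2 \<ge> (1 :: real)" using ln_2_less_1 by (simp add: field_simps)
  have bounds: "(1 / ln 2 - (1 / 2) ^ n) * J \<le> gauss_kuzmin_measure (Suc n) k"
    "gauss_kuzmin_measure (Suc n) k \<le> (1 / ln 2 + (1 / 2) ^ n) * J" for n
  proof -
    have near: "1 / ln 2 - (1 / 2) ^ n \<le> gk_density n y" "gk_density n y \<le> 1 / ln 2 + (1 / 2) ^ n"
      if "y \<in> I" for y
      using gk_density_near_limit[OF I01[OF that], of n] by linarith+
    have pw: "(1 / 2 :: real) ^ n \<le> 1" by (simp add: power_le_one)
    have pos: "1 / ln 2 - (1 / 2) ^ n \<ge> (0::real)" "1 / ln 2 + (1 / 2) ^ n \<ge> (0::real)"
      using ln2 pw zero_le_power[of "1 / 2 :: real" n] by linarith+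
    have P0: "gauss_kuzmin_measure (Suc n) k \<ge> 0" by (simp add: gauss_kuzmin_measure_def)
    have "ennreal ((1 / ln 2 - (1 / 2) ^ n) * J) \<le> ennreal (gauss_kuzmin_measure (Suc n) k)"
      unfolding gauss_kuzmin_measure_Suc[OF k] c[OF pos(1), symmetric] I_def[symmetric]
    proof (rule nn_integral_mono)
      fix y show "ennreal ((1 / ln 2 - (1 / 2) ^ n) / (1 + y)) * indicator I y
          \<le> ennreal (gk_density n y / (1 + y)) * indicator I y"
        using near(1)[of y] I01[of y]
        by (cases "y \<in> I") (auto intro!: ennreal_leI divide_right_mono)
    qed
    then show "(1 / ln 2 - (1 / 2) ^ n) * J \<le> gauss_kuzmin_measure (Suc n) k" using P0 by simp
    have "ennreal (gauss_kuzmin_measure (Suc n) k) \<le> ennreal ((1 / ln 2 + (1 / 2) ^ n) * J)"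
      unfolding gauss_kuzmin_measure_Suc[OF k] c[OF pos(2), symmetric] I_def[symmetric]
    proof (rule nn_integral_mono)
      fix y show "ennreal (gk_density n y / (1 + y)) * indicator I y
          \<le> ennreal ((1 / ln 2 + (1 / 2) ^ n) / (1 + y)) * indicator I y"
        using near(2)[of y] I01[of y]
        by (cases "y \<in> I") (auto intro!: ennreal_leI divide_right_mono)
    qed
    then show "gauss_kuzmin_measure (Suc n) k \<le> (1 / ln 2 + (1 / 2) ^ n) * J" 
      using pos J0 by (simp add: ennreal_le_iff)
  qed
  have lim: "(\<lambda>n. (1 / ln 2 - (1 / 2) ^ n) * J) \<longlonglongrightarrow> (1 / ln 2 - 0) * J"
    "(\<lambda>n. (1 / ln 2 + (1 / 2) ^ n) * J) \<longlonglongrightarrow> (1 / ln 2 + 0) * J"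
    by (intro tendsto_intros LIMSEQ_power_zero; simp)+
  have "(\<lambda>n. gauss_kuzmin_measure (Suc n) k) \<longlonglongrightarrow> 1 / ln 2 * J"
    by (rule tendsto_sandwich[of "\<lambda>n. (1 / ln 2 - (1 / 2) ^ n) * J" _ _ "\<lambda>n. (1 / ln 2 + (1 / 2) ^ n) * J"])
       (use bounds lim in \<open>simp_all del: One_nat_def\<close>)
  then have "(\<lambda>n. gauss_kuzmin_measure (Suc n) k) \<longlonglongrightarrow> J / ln 2" by simp
  then show ?thesis unfolding J_def by (rule LIMSEQ_imp_Suc)
qed

section \<open>Proportionality of the two frequencies\<close>

lemma ln2_double_integral:
  "ln (2::real) = (LBINT x:{-1..0}. (LBINT y:{1..}. 1 / (x - y)^2))"
proof -
  have inner: "(LBINT y:{1..}. 1 / (x - y)^2) = 1 / (1 - x)" if x: "x \<in> {-1..0}" for x :: real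
  proof -
    have "(LBINT y:{1..}. 1 / (x - y)^2) = enn2real (\<integral>\<^sup>+y. ennreal (indicator {1..} y *\<^sub>R (1 / (x - y)^2)) \<partial>lborel)"
      unfolding set_lebesgue_integral_def by (rule integral_eq_nn_integral) auto
    also have "(\<integral>\<^sup>+y. ennreal (indicator {1..} y *\<^sub>R (1 / (x - y)^2)) \<partial>lborel)
       = (\<integral>\<^sup>+y. ennreal (1 / (x - y)^2) * indicator {1..} y \<partial>lborel)"
      by (rule nn_integral_cong) (simp add: indicator_def)
    also have "\<dots> = ennreal (0 - 1 / (x - 1))"
    proof (rule nn_integral_FTC_atLeast[where F = "\<lambda>y. 1 / (x - y)"])
      fix y :: real assume "1 \<le> y"
      then have "x - y \<noteq> 0" using x by auto
      then show "((\<lambda>y. 1 / (x - y)) has_real_derivative 1 / (x - y)^2) (at y)"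
        by (auto intro!: derivative_eq_intros simp: power2_eq_square)
    next
      have "filterlim (\<lambda>y. - x + y) at_top at_top"
        by (rule filterlim_tendsto_add_at_top[OF tendsto_const filterlim_ident])
      then have "((\<lambda>y. - 1 / (- x + y)) \<longlongrightarrow> 0) at_top"
        by (rule real_tendsto_divide_at_top[OF tendsto_const])
      moreover have "- 1 / (- x + y) = 1 / (x - y)" for y
        by (metis add.commute diff_conv_add_uminus minus_diff_eq minus_divide_divide minus_minus)
      ultimately show "((\<lambda>y. 1 / (x - y)) \<longlongrightarrow> 0) at_top" by simp
    qed auto
    also have "0 - 1 / (x - 1) = 1 / (1 - x)" by (metis diff_0 minus_diff_eq minus_divide_right)
    finally show ?thesis using x by simp
  qed
  have "(LBINT x:{-1..0}. (LBINT y:{1..}. 1 / (x - y)^2)) = (LBINT x:{-1..0}. (1 / (1 - x) :: real))"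
    by (rule set_lebesgue_integral_cong) (use inner in auto)
  also have "\<dots> = enn2real (\<integral>\<^sup>+x. ennreal (indicator {-1..0} x *\<^sub>R (1 / (1 - x))) \<partial>lborel)"
    unfolding set_lebesgue_integral_def
    by (rule integral_eq_nn_integral) (auto simp: indicator_def intro!: AE_I2)
  also have "(\<integral>\<^sup>+x. ennreal (indicator {-1..0} x *\<^sub>R (1 / (1 - x))) \<partial>lborel)
     = (\<integral>\<^sup>+x. ennreal (1 / (1 - x)) * indicator {-1..0} x \<partial>lborel)"
    by (rule nn_integral_cong) (simp add: indicator_def)
  also have "\<dots> = ennreal (- ln (1 - 0) - (- ln (1 - (-1))))"
  proof (rule nn_integral_FTC_Icc[where F = "\<lambda>x. - ln (1 - x)"])
    fix x :: real assume "x \<in> {-1..0}"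
    then show "((\<lambda>x. - ln (1 - x)) has_real_derivative 1 / (1 - x)) (at x)"
      by (auto intro!: derivative_eq_intros)
  qed auto
  finally show ?thesis by simp
qed

theorem corollary3p7:
  fixes k :: nat and a b :: "real^2"
  assumes "k > 0"
    and "a \<in> int_points" and "b \<in> int_points" and "a \<noteq> b"
    and "int_length a b = k"
    and "unit_int_distance (affine hull {a, b})"
  shows "ln (2::real) = (LBINT x:{-1..0}. (LBINT y:{1..}. 1 / (x - y)^2))
    \<and> convergent (\<lambda>n. gauss_kuzmin_measure n k)
    \<and> mu1 (CF1_with_face (closed_segment a b)) = ennreal (ln 2 * gauss_kuzmin_freq k)"
proof (intro conjI)
  show "ln (2::real) = (LBINT x:{-1..0}. (LBINT y:{1..}. 1 / (x - y)^2))"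
    by (rule ln2_double_integral)
  note lim = gauss_kuzmin_theorem[OF \<open>k > 0\<close>]
  show "convergent (\<lambda>n. gauss_kuzmin_measure n k)" using lim by (rule convergentI)
  obtain e where b: "b = a + real k *\<^sub>R e" and basis: "integer_basis a e k"
    using segment_integer_basis[OF assms] by blast
  have "ln 2 * gauss_kuzmin_freq k = ln ((real k + 1)^2 / (real k * (real k + 2)))"
    using limI[OF lim] by (simp add: gauss_kuzmin_freq_def)
  then show "mu1 (CF1_with_face (closed_segment a b)) = ennreal (ln 2 * gauss_kuzmin_freq k)"
    using integer_basis.mu1_segment[OF basis] b by simp
qed

end
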